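(* Let $D\subset\mathbb R^d$ be compact with $\mu(D)>0$, let $\kappa>0$, and let $\nu:D\to\mathbb R$, $\theta^0:D\to\mathbb R$ and $\phi:D\times D\to(0,\infty)$ with $\phi(x,y)=\phi(y,x)$. Suppose: (B1) there is a sequence of partitions $\mathcal P^N=\{D^N_\alpha\}_{\alpha=1}^{2^N}$ ($N\ge0$) of $D$ into measurable sets with $\mathcal P^0=\{D^0_1\}=\{D\}$, $\lim_{N\to\infty}\max_{1\le\alpha\le2^N}\mathrm{diam}(D^N_\alpha)=0$, and, for $1\le\alpha\le2^N$, $D^N_\alpha$ is the disjoint union of $D^{N+1}_{2\alpha-1}$ and $D^{N+1}_{2\alpha}$ with $\mu(D^{N+1}_{2\alpha-1})=\mu(D^{N+1}_{2\alpha})$; (B2) $\nu$, $\phi$ and $\theta^0$ are continuous; (B3) there exist $b_\Phi\ge a_\Phi>0$, $-L<a_G<b_G<L$ and $\theta_*\in(0,\pi/2)$ such that $$\mathcal D(\theta^0)\le\theta_*,\quad a_\Phi\le\phi(x,y)\le b_\Phi\ \ \forall x,y\in D,\quad \kappa>\max\Big\{\frac{\mathcal D(\nu)}{a_\Phi\sin\theta_*},\frac{2M_{\mathcal Q^{-1}[F]}}{a_\Phi m_{G'}^2\cos\theta_*}\Big\},$$ $$F(a_G)+\kappa b_\Phi\le\nu(x)\le F(b_G)-\kappa b_\Phi\quad\forall x\in D.$$ For each $N\ge 1$ let $\theta^N(t,x)=\sum_{\alpha=1}^{2^N}\theta^N_\alpha(t)\mathbf 1_{D^N_\alpha}(x)$,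 where $\{\theta^N_\alpha\}_{\alpha=1}^{2^N}$ is the global smooth solution of the lattice model $$F(\dot\theta_\alpha)=\nu^N_\alpha+\frac{\kappa}{2^N}\sum_{\beta=1}^{2^N}\phi^N_{\alpha\beta}\sin(\theta_\beta-\theta_\alpha),\ t>0,\qquad \theta_\alpha(0)=\theta^{N,0}_\alpha,$$ with $$\nu^N_\alpha=\frac{2^N}{\mu(D)}\int_{D^N_\alpha}\nu\,d\mu,\quad \theta^{N,0}_\alpha=\frac{2^N}{\mu(D)}\int_{D^N_\alpha}\theta^0\,d\mu,\quad \phi^N_{\alpha\beta}=\frac{2^{2N}}{\mu(D)^2}\iint_{D^N_\alpha\times D^N_\beta}\phi(x,y)\,d\mu(x)d\mu(y).$$ Then there exists a unique limit $\theta\in C^1([0,\infty);L^\infty(D))$ satisfying the following two assertions: (1) $\displaystyle\lim_{N\to\infty}\sup_{t\ge0}\ \underset{x\in D}{\mathrm{ess\,sup}}\,|\theta^N(t,x)-\theta(t,x)|=0$. (2) $\theta$ admits a continuous version which is the unique classical solution to the continuum generalized Kuramoto model with data $(\nu,\phi,\theta^0)$.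
   Context: Let $L\in(0,\infty]$ and let $F:(-L,L)\to\mathbb R$ be a $C^2$ function with $F(-\theta)=-F(\theta)$ and $F'(\theta)>0$ for all $\theta\in(-L,L)$; $G=F^{-1}$. $\mu$ is Lebesgue measure on $\mathbb R^d$. Continuum generalized Kuramoto model: $$F(\partial_t\theta(t,x))=\nu(x)+\frac{\kappa}{\mu(D)}\int_D\phi(x,z)\sin(\theta(t,z)-\theta(t,x))\,d\mu(z),\ t>0,\qquad\theta(0,x)=\theta^0(x).$$ A (global) classical solution is a function $\theta\in C^1([0,\infty);L^\infty(D))$ satisfying the integro-differential equation for all $t\ge0$ and a.e. $x\in D$, and $\theta(0,x)=\theta^0(x)$ for a.e. $x\in D$. Notation: $\mathcal D(f)=\sup_Df-\inf_Df$ for a function $f$ on $D$; $m_{G'}=\min_{F(a_G)\le y\le F(b_G)}G'(y)$; $M_{\mathcal Q^{-1}[F]}=\max_{(x,y)\in[a_G,b_G]^2}\mathcal Q^{-1}[F](x,y)$, where $\mathcal Q^{-1}[F](x,y)=\frac{x-y}{F(x)-F(y)}$ if $x\ne y$ and $\mathcal Q^{-1}[F](x,x)=\frac1{F'(x)}$. *)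

theory Defs
  imports "HOL-Analysis.Analysis" "HOL-Probability.Essential_Supremum"
begin

definition sym_interval :: "ereal \<Rightarrow> real set" where
  "sym_interval L = {v. - L < ereal v \<and> ereal v < L}"

definition C2_on :: "real set \<Rightarrow> (real \<Rightarrow> real) \<Rightarrow> bool" where
  "C2_on S F \<longleftrightarrow> (\<forall>v\<in>S. F field_differentiable at v) \<and> deriv F C1_differentiable_on S"

definition osc :: "'a set \<Rightarrow> ('a \<Rightarrow> real) \<Rightarrow> real" where
  "osc D f = (SUP x\<in>D. f x) - (INF x\<in>D. f x)"

text \<open>The function \<open>F\<close> only matters on \<open>sym_interval L\<close>; its inverse \<open>G\<close> is the inverse of that
  restriction. The minimum and the maximum below are written as infimum and supremum (of a continuous
  function on a nonempty compact set).\<close>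

definition min_deriv_inverse :: "ereal \<Rightarrow> (real \<Rightarrow> real) \<Rightarrow> real \<Rightarrow> real \<Rightarrow> real" where
  "min_deriv_inverse L F a b = (INF y\<in>{F a..F b}. deriv (the_inv_into (sym_interval L) F) y)"

definition inv_quotient :: "(real \<Rightarrow> real) \<Rightarrow> real \<Rightarrow> real \<Rightarrow> real" where
  "inv_quotient F x y = (if x = y then 1 / deriv F x else (x - y) / (F x - F y))"

definition max_inv_quotient :: "(real \<Rightarrow> real) \<Rightarrow> real \<Rightarrow> real \<Rightarrow> real" where
  "max_inv_quotient F a b = (SUP (x, y)\<in>{a..b} \<times> {a..b}. inv_quotient F x y)"

text \<open>Cells are indexed by \<open>1, \<dots>, 2^N\<close> at level \<open>N\<close>; other indices are irrelevant.\<close>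

definition dyadic_partitions :: "'a::euclidean_space set \<Rightarrow> (nat \<Rightarrow> nat \<Rightarrow> 'a set) \<Rightarrow> bool" where
  "dyadic_partitions D P \<longleftrightarrow>
     P 0 1 = D \<and>
     (\<forall>N. (\<forall>\<alpha>\<in>{1..2^N}. P N \<alpha> \<in> sets lebesgue) \<and>
          (\<Union>\<alpha>\<in>{1..2^N}. P N \<alpha>) = D \<and> disjoint_family_on (P N) {1..2^N}) \<and>
     (\<lambda>N. Max ((\<lambda>\<alpha>. diameter (P N \<alpha>)) ` {1..2^N})) \<longlonglongrightarrow> 0 \<and>
     (\<forall>N. \<forall>\<alpha>\<in>{1..2^N}.
        P N \<alpha> = P (Suc N) (2 * \<alpha> - 1) \<union> P (Suc N) (2 * \<alpha>) \<and>
        P (Suc N) (2 * \<alpha> - 1) \<inter> P (Suc N) (2 * \<alpha>) = {} \<and>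
        measure lebesgue (P (Suc N) (2 * \<alpha> - 1)) = measure lebesgue (P (Suc N) (2 * \<alpha>)))"

definition cell_mean :: "'a::euclidean_space set \<Rightarrow> nat \<Rightarrow> 'a set \<Rightarrow> ('a \<Rightarrow> real) \<Rightarrow> real" where
  "cell_mean D N A f = 2 ^ N / measure lebesgue D * (LINT x:A|lebesgue. f x)"

definition cell_mean2 ::
    "'a::euclidean_space set \<Rightarrow> nat \<Rightarrow> 'a set \<Rightarrow> 'a set \<Rightarrow> ('a \<Rightarrow> 'a \<Rightarrow> real) \<Rightarrow> real" where
  "cell_mean2 D N A B \<phi> =
     2 ^ (2 * N) / (measure lebesgue D)\<^sup>2 *
       (LINT z:A \<times> B|lebesgue \<Otimes>\<^sub>M lebesgue. \<phi> (fst z) (snd z))"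

text \<open>Global \<open>C\<^sup>1\<close> solutions of the lattice model with \<open>n\<close> oscillators. The equation involves
  \<open>F (\<theta>' t)\<close>, so it includes the requirement that \<open>\<theta>' t\<close> lies in the domain of \<open>F\<close>.\<close>

definition lattice_solution ::
    "ereal \<Rightarrow> (real \<Rightarrow> real) \<Rightarrow> real \<Rightarrow> nat \<Rightarrow> (nat \<Rightarrow> real) \<Rightarrow> (nat \<Rightarrow> nat \<Rightarrow> real) \<Rightarrow> (nat \<Rightarrow> real) \<Rightarrow>
     (nat \<Rightarrow> real \<Rightarrow> real) \<Rightarrow> bool" where
  "lattice_solution L F \<kappa> n \<nu> \<phi> \<theta>0 \<theta> \<longleftrightarrow>
     (\<forall>\<alpha>\<in>{1..n}. \<theta> \<alpha> 0 = \<theta>0 \<alpha> \<and>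
        (\<exists>\<theta>'. continuous_on {0..} \<theta>' \<and>
           (\<forall>t\<ge>0. (\<theta> \<alpha> has_real_derivative \<theta>' t) (at t within {0..})) \<and>
           (\<forall>t>0. \<theta>' t \<in> sym_interval L \<and>
              F (\<theta>' t) = \<nu> \<alpha> + \<kappa> / real n * (\<Sum>\<beta>\<in>{1..n}. \<phi> \<alpha> \<beta> * sin (\<theta> \<beta> t - \<theta> \<alpha> t)))))"

definition step_function ::
    "(nat \<Rightarrow> nat \<Rightarrow> 'a set) \<Rightarrow> (nat \<Rightarrow> nat \<Rightarrow> real \<Rightarrow> real) \<Rightarrow> nat \<Rightarrow> real \<Rightarrow> 'a \<Rightarrow> real" where
  "step_function P \<Theta> N t x = (\<Sum>\<alpha>\<in>{1..2^N}. \<Theta> N \<alpha> t * indicator (P N \<alpha>) x)"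

text \<open>Elements of \<open>L\<^sup>\<infinity>\<close> are represented by functions; equality in \<open>L\<^sup>\<infinity>\<close> is equality almost everywhere.\<close>

definition Linfty_norm :: "'a measure \<Rightarrow> ('a \<Rightarrow> real) \<Rightarrow> ereal" where
  "Linfty_norm M f = esssup M (\<lambda>x. ereal \<bar>f x\<bar>)"

definition Linfty :: "'a measure \<Rightarrow> ('a \<Rightarrow> real) set" where
  "Linfty M = {f \<in> borel_measurable M. Linfty_norm M f < \<infinity>}"

text \<open>\<open>\<theta> \<in> C\<^sup>1([0,\<infinity>); L\<^sup>\<infinity>)\<close> with derivative \<open>\<theta>'\<close> (one-sided at \<open>0\<close>); limits are taken in the norm of
  \<open>L\<^sup>\<infinity>\<close>.\<close>

definition C1_Linfty_with ::
    "'a measure \<Rightarrow> (real \<Rightarrow> 'a \<Rightarrow> real) \<Rightarrow> (real \<Rightarrow> 'a \<Rightarrow> real) \<Rightarrow> bool" where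
  "C1_Linfty_with M \<theta> \<theta>' \<longleftrightarrow>
     (\<forall>t\<ge>0. \<theta> t \<in> Linfty M \<and> \<theta>' t \<in> Linfty M) \<and>
     (\<forall>t\<ge>0. ((\<lambda>s. Linfty_norm M (\<lambda>x. (\<theta> s x - \<theta> t x) / (s - t) - \<theta>' t x)) \<longlongrightarrow> 0) (at t within {0..})) \<and>
     (\<forall>t\<ge>0. ((\<lambda>s. Linfty_norm M (\<lambda>x. \<theta>' s x - \<theta>' t x)) \<longlongrightarrow> 0) (at t within {0..}))"

definition C1_Linfty :: "'a measure \<Rightarrow> (real \<Rightarrow> 'a \<Rightarrow> real) \<Rightarrow> bool" where
  "C1_Linfty M \<theta> \<longleftrightarrow> (\<exists>\<theta>'. C1_Linfty_with M \<theta> \<theta>')"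

definition Linfty_curve_eq ::
    "'a measure \<Rightarrow> (real \<Rightarrow> 'a \<Rightarrow> real) \<Rightarrow> (real \<Rightarrow> 'a \<Rightarrow> real) \<Rightarrow> bool" where
  "Linfty_curve_eq M \<theta> \<psi> \<longleftrightarrow> (\<forall>t\<ge>0. AE x in M. \<theta> t x = \<psi> t x)"

definition classical_solution ::
    "ereal \<Rightarrow> (real \<Rightarrow> real) \<Rightarrow> real \<Rightarrow> 'a::euclidean_space set \<Rightarrow> ('a \<Rightarrow> real) \<Rightarrow> ('a \<Rightarrow> 'a \<Rightarrow> real) \<Rightarrow>
     ('a \<Rightarrow> real) \<Rightarrow> (real \<Rightarrow> 'a \<Rightarrow> real) \<Rightarrow> bool" where
  "classical_solution L F \<kappa> D \<nu> \<phi> \<theta>0 \<theta> \<longleftrightarrow>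
     (\<exists>\<theta>'. C1_Linfty_with (lebesgue_on D) \<theta> \<theta>' \<and>
        (\<forall>t\<ge>0. AE x in lebesgue_on D. \<theta>' t x \<in> sym_interval L \<and>
           F (\<theta>' t x) = \<nu> x + \<kappa> / measure lebesgue D *
                          (LINT z:D|lebesgue. \<phi> x z * sin (\<theta> t z - \<theta> t x)))) \<and>
     (AE x in lebesgue_on D. \<theta> 0 x = \<theta>0 x)"

definition uniform_limit_of_lattice ::
    "'a::euclidean_space set \<Rightarrow> (nat \<Rightarrow> nat \<Rightarrow> 'a set) \<Rightarrow> (nat \<Rightarrow> nat \<Rightarrow> real \<Rightarrow> real) \<Rightarrow>
     (real \<Rightarrow> 'a \<Rightarrow> real) \<Rightarrow> bool" where
  "uniform_limit_of_lattice D P \<Theta> \<theta> \<longleftrightarrow>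
     (\<lambda>N. SUP t\<in>{0..}. Linfty_norm (lebesgue_on D) (\<lambda>x. step_function P \<Theta> N t x - \<theta> t x))
       \<longlonglongrightarrow> 0"

definition continuous_version_is_unique_solution ::
    "ereal \<Rightarrow> (real \<Rightarrow> real) \<Rightarrow> real \<Rightarrow> 'a::euclidean_space set \<Rightarrow> ('a \<Rightarrow> real) \<Rightarrow> ('a \<Rightarrow> 'a \<Rightarrow> real) \<Rightarrow>
     ('a \<Rightarrow> real) \<Rightarrow> (real \<Rightarrow> 'a \<Rightarrow> real) \<Rightarrow> bool" where
  "continuous_version_is_unique_solution L F \<kappa> D \<nu> \<phi> \<theta>0 \<theta> \<longleftrightarrow>
     (\<exists>\<psi>. continuous_on ({0..} \<times> D) (\<lambda>(t, x). \<psi> t x) \<and>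
          Linfty_curve_eq (lebesgue_on D) \<psi> \<theta> \<and>
          classical_solution L F \<kappa> D \<nu> \<phi> \<theta>0 \<psi> \<and>
          (\<forall>\<eta>. classical_solution L F \<kappa> D \<nu> \<phi> \<theta>0 \<eta> \<longrightarrow> Linfty_curve_eq (lebesgue_on D) \<eta> \<psi>))"

end

theory Submission
  imports Defs
begin

text \<open>The cells of level \<open>N\<close> have equal measure, so the lattice sums are integrals of step functions over
\<open>D\<close>, and the step function \<open>\<theta>\<^sup>N\<close> solves the continuum equation with the cell averages of \<open>\<nu>\<close>, \<open>\<phi>\<close> and
\<open>\<theta>\<^sup>0\<close> in place of the data. By uniform continuity these averages converge to the data uniformly on
\<open>D\<close>. What has to be shown is that solutions depend on the data in a way that is uniform in \<open>N\<close> and in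
time.

Since \<open>F' \<ge> m > 0\<close> on \<open>[a\<^sub>G, b\<^sub>G]\<close>, two frequencies differ by at most \<open>1/m\<close> times the difference of the
two right-hand sides, and Gronwall's inequality gives stability on bounded time intervals
(\<open>finite_time_stability\<close>). Its constant grows exponentially, so large times need a different
mechanism, which is synchronization:
\<^item> The diameter of the phases never exceeds \<open>\<theta>\<^sub>*\<close>, because at that diameter the coupling beats the
  spread of \<open>\<nu>\<close> (\<open>phase_diff_le\<close>).
\<^item> Hence all cosines of phase differences stay above \<open>cos \<theta>\<^sub>* > 0\<close>. The equation differentiated in
  time is then a linear consensus equation for the frequencies, with weights bounded below, and
  the spread of the frequencies decays exponentially at a rate independent of \<open>N\<close>
  (\<open>frequency_diff_decay\<close>).
\<^item> The coupling is antisymmetric, so the mean of \<open>F\<close> over the frequencies is the mean of \<open>\<nu>\<close>, which is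
  the same at all levels. Therefore all frequencies at all levels tend to the same number \<open>c\<close> with
  \<open>F c\<close> equal to the mean of \<open>\<nu>\<close> (\<open>frequency_decay\<close>).

So after time \<open>T\<close> the difference of two lattice solutions changes by at most a multiple of
\<open>exp (- \<rho> T)\<close> (\<open>tail_stability\<close>). Choosing first \<open>T\<close> and then the levels shows that the step functions
are uniformly Cauchy on \<open>[0, \<infinity>) \<times> D\<close> (\<open>uniformly_Cauchy\<close>). The frequencies converge along with the
phases, since they are functions of them, and a remainder estimate \<open>W (s - t)\<^sup>2\<close> for the first-order
Taylor expansion in time that is uniform in \<open>N\<close> and \<open>x\<close> survives in the limit \<open>\<psi>\<close>: it is \<open>C\<^sup>1\<close> in time for
the supremum norm and solves the continuum equation at every point of \<open>D\<close>. Gronwall's inequality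
for \<open>\<psi>(t, x) - \<psi>(t, y)\<close> yields continuity in \<open>x\<close> (\<open>spatial_modulus\<close>). Finally the essential supremum of
the difference of two classical solutions satisfies a differential inequality of Dini type that
forces it to vanish (\<open>classical_solution_unique\<close>).\<close>

section \<open>Barrier arguments and Gronwall inequalities\<close>

lemma at_within_nonneg: "at t within {0..} = at t" if "0 < t" for t :: real
  by (rule at_within_interior) (use that in simp)

text \<open>If some member of the family reached zero there would be a first such time. Up to then all members
are negative, and this contradicts positivity of the vanishing member just before. The left-sided
condition replaces a derivative so that the lemma also applies to a norm, which need not be
differentiable. Finiteness is required only of the set of functions: an infinite set of labels is
allowed, which matters for step functions on \<open>D\<close>.\<close>

lemma first_crossing:
  fixes u :: "'i \<Rightarrow> real \<Rightarrow> real"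
  assumes fin: "finite (u ` I)"
    and cont: "\<And>i. i \<in> I \<Longrightarrow> continuous_on {0..} (u i)"
    and init: "\<And>i. i \<in> I \<Longrightarrow> u i 0 < 0"
    and cross: "\<And>i t. i \<in> I \<Longrightarrow> 0 < t \<Longrightarrow> (\<And>j. j \<in> I \<Longrightarrow> u j t \<le> 0) \<Longrightarrow> u i t = 0 \<Longrightarrow>
                  \<forall>\<^sub>F s in at_left t. 0 < u i s"
    and i: "i \<in> I" and t: "0 \<le> t"
  shows "u i t < 0"
proof (rule ccontr)
  assume "\<not> u i t < 0"
  define Z where "Z = (\<Union>f\<in>u ` I. {s \<in> {0..t}. 0 \<le> f s})"
  have "closed {s \<in> {0..t}. 0 \<le> f s}" if "f \<in> u ` I" for f
  proof -
    have "continuous_on {0..t} f"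
      using that continuous_on_subset[OF cont, of _ "{0..t}"] by auto
    then show ?thesis
      using continuous_closed_preimage[of "{0..t}" f "{0..}"] by (simp add: vimage_def Int_def conj_commute)
  qed
  then have "closed Z"
    unfolding Z_def using fin by (intro closed_UN) auto
  moreover have "t \<in> Z"
    using i t \<open>\<not> u i t < 0\<close> by (auto simp: Z_def not_less)
  moreover have Z_bdd: "bdd_below Z"
    by (rule bdd_belowI[of _ 0]) (auto simp: Z_def)
  ultimately have "Inf Z \<in> Z"
    by (metis closed_contains_Inf empty_iff)
  then obtain k where k: "k \<in> I" "0 \<le> u k (Inf Z)" and r: "0 \<le> Inf Z" "Inf Z \<le> t"
    by (auto simp: Z_def)
  define r where "r = Inf Z"
  note r = r[folded r_def] and k = k[folded r_def]
  have before: "u j s < 0" if "j \<in> I" "0 \<le> s" "s < r" for j s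
  proof (rule ccontr)
    assume "\<not> u j s < 0"
    moreover have "s \<le> t" using that r by simp
    ultimately have "s \<in> Z" using that by (auto simp: Z_def not_less)
    then have "r \<le> s" using Z_bdd by (simp add: r_def cInf_lower)
    then show False using that by simp
  qed
  have "r \<noteq> 0" using init[OF k(1)] k(2) r_def by auto
  then have r0: "0 < r" using r r_def by simp
  have ev: "\<forall>\<^sub>F s in at_left r. 0 < s \<and> s < r"
    using eventually_at_left_real[OF r0] by (simp add: eventually_mono)
  have nonpos: "u j r \<le> 0" if "j \<in> I" for j
  proof (rule tendsto_upperbound)
    have "isCont (u j) r"
      using cont[OF that] r0 by (simp add: continuous_on_interior)
    then show "(u j \<longlongrightarrow> u j r) (at_left r)"
      by (simp add: isCont_def filterlim_at_split)
    show "\<forall>\<^sub>F s in at_left r. u j s \<le> 0"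
      using ev by eventually_elim (use before that in \<open>simp add: less_imp_le\<close>)
  qed simp
  have "u k r = 0" using nonpos[OF k(1)] k(2) by simp
  then have "\<forall>\<^sub>F s in at_left r. 0 < u k s"
    using cross[OF k(1) r0] nonpos by blast
  with ev have "\<forall>\<^sub>F s in at_left r. False"
  proof eventually_elim
    case (elim s)
    then show ?case using before[OF k(1), of s] by simp
  qed
  then show False by simp
qed

lemma eventually_at_left_pos_of_deriv_neg:
  fixes f :: "real \<Rightarrow> real"
  assumes "(f has_real_derivative l) (at t)" "l < 0" "f t = 0"
  shows "\<forall>\<^sub>F s in at_left t. 0 < f s"
proof -
  obtain d where d: "d > 0" "\<And>h. 0 < h \<Longrightarrow> h < d \<Longrightarrow> f t < f (t - h)"
    using has_real_derivative_neg_dec_left[OF assms(1,2)] by auto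
  have "\<forall>\<^sub>F s in at_left t. s \<in> {t - d<..<t}"
    by (rule eventually_at_left_real) (use d in simp)
  then show ?thesis
  proof eventually_elim
    case (elim s)
    then show ?case using d(2)[of "t - s"] assms(3) by simp
  qed
qed

corollary negative_of_deriv_neg_at_zeros:
  fixes u u' :: "'i \<Rightarrow> real \<Rightarrow> real"
  assumes "finite (u ` I)"
    and "\<And>i. i \<in> I \<Longrightarrow> continuous_on {0..} (u i)"
    and "\<And>i. i \<in> I \<Longrightarrow> u i 0 < 0"
    and der: "\<And>i t. i \<in> I \<Longrightarrow> 0 < t \<Longrightarrow> (u i has_real_derivative u' i t) (at t)"
    and neg: "\<And>i t. i \<in> I \<Longrightarrow> 0 < t \<Longrightarrow> (\<And>j. j \<in> I \<Longrightarrow> u j t \<le> 0) \<Longrightarrow> u i t = 0 \<Longrightarrow> u' i t < 0"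
    and "i \<in> I" and "0 \<le> t"
  shows "u i t < 0"
  by (rule first_crossing[OF assms(1-3) _ assms(6-7)])
     (blast intro: eventually_at_left_pos_of_deriv_neg der neg)+

text \<open>The bound on \<open>d' i\<close> involves the maximum over the whole family, which is not differentiable. Instead
all functions \<open>\<plusminus> d i - B exp ((C + 1) t)\<close> with \<open>B > A\<close> are kept below zero simultaneously. The exponent
\<open>C + 1\<close> instead of \<open>C\<close> absorbs the inhomogeneous term \<open>A\<close>.\<close>

lemma gronwall_finite_family:
  fixes d d' :: "'i \<Rightarrow> real \<Rightarrow> real"
  assumes fin: "finite (d ` I)"
    and cont: "\<And>i. i \<in> I \<Longrightarrow> continuous_on {0..} (d i)"
    and der: "\<And>i t. i \<in> I \<Longrightarrow> 0 < t \<Longrightarrow> (d i has_real_derivative d' i t) (at t)"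
    and bound: "\<And>i t m. i \<in> I \<Longrightarrow> 0 < t \<Longrightarrow> (\<And>j. j \<in> I \<Longrightarrow> \<bar>d j t\<bar> \<le> m) \<Longrightarrow> \<bar>d' i t\<bar> \<le> A + C * m"
    and init: "\<And>i. i \<in> I \<Longrightarrow> \<bar>d i 0\<bar> \<le> A" and C: "0 \<le> C"
    and i: "i \<in> I" and t: "0 \<le> t"
  shows "\<bar>d i t\<bar> \<le> A * exp ((C + 1) * t)"
proof -
  have less: "\<bar>d i t\<bar> < B * exp ((C + 1) * t)" if B: "A < B" for B
  proof -
    define b where "b s = B * exp ((C + 1) * s)" for s
    define u where "u = (\<lambda>(j, \<sigma>::real) s. \<sigma> * d j s - b s)"
    define u' where "u' = (\<lambda>(j, \<sigma>::real) s. \<sigma> * d' j s - (C + 1) * b s)"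
    define J where "J = I \<times> {-1, 1::real}"
    have b_der: "(b has_real_derivative (C + 1) * b s) (at s)" for s
      unfolding b_def by (auto intro!: derivative_eq_intros)
    have b_cont: "continuous_on {0..} b"
      unfolding b_def by (intro continuous_intros)
    have neg: "u p s < 0" if p: "p \<in> J" "0 \<le> s" for p s
    proof (rule negative_of_deriv_neg_at_zeros[of u J u' p s, OF _ _ _ _ _ p])
      have "u ` J = (\<lambda>(f, \<sigma>::real) s. \<sigma> * f s - b s) ` (d ` I \<times> {-1, 1})"
        unfolding u_def J_def by (auto simp: image_iff)
      then show "finite (u ` J)" using fin by simp
    next
      show "continuous_on {0..} (u p)" if "p \<in> J" for p
        using that cont b_cont by (auto simp: u_def J_def intro!: continuous_intros)
    next
      show "u p 0 < 0" if "p \<in> J" for p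
        using that init B by (fastforce simp: u_def J_def b_def)
    next
      show "(u p has_real_derivative u' p r) (at r)" if "p \<in> J" "0 < r" for p r
        using that der b_der by (auto simp: u_def u'_def J_def intro!: derivative_eq_intros)
    next
      fix p r assume p: "p \<in> J" "0 < r" and le: "\<And>q. q \<in> J \<Longrightarrow> u q r \<le> 0"
      obtain j \<sigma> where j: "p = (j, \<sigma>)" "j \<in> I" "\<sigma> = -1 \<or> \<sigma> = 1" using p by (auto simp: J_def)
      have "\<bar>d k r\<bar> \<le> b r" if "k \<in> I" for k
        using le[of "(k, 1)"] le[of "(k, -1)"] that by (auto simp: u_def J_def)
      then have "\<bar>d' j r\<bar> \<le> A + C * b r" by (rule bound[OF j(2) p(2)])
      moreover have "A < b r"
      proof -
        have "1 \<le> exp ((C + 1) * r)" using p C by simp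
        moreover have "0 \<le> B" using init[OF j(2)] B by linarith
        ultimately show ?thesis
          using B mult_left_mono[of 1 "exp ((C + 1) * r)" B] by (simp add: b_def)
      qed
      ultimately show "u' p r < 0" using j by (auto simp: u'_def algebra_simps)
    qed
    show ?thesis
      using neg[of "(i, 1)" t] neg[of "(i, -1)" t] i t by (auto simp: u_def J_def b_def)
  qed
  show ?thesis
  proof (rule field_le_epsilon)
    fix e :: real assume "0 < e"
    have "\<bar>d i t\<bar> < (A + e / exp ((C + 1) * t)) * exp ((C + 1) * t)"
      by (rule less) (use \<open>0 < e\<close> in simp)
    then show "\<bar>d i t\<bar> \<le> A * exp ((C + 1) * t) + e"
      by (simp add: algebra_simps)
  qed
qed

text \<open>A Gronwall inequality for functions that are only controlled through difference quotients. It is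
used for an essential supremum norm.\<close>

lemma dini_gronwall_zero:
  fixes w :: "real \<Rightarrow> real"
  assumes nonneg: "\<And>t. 0 \<le> t \<Longrightarrow> 0 \<le> w t" and init: "w 0 = 0" and C: "0 \<le> C"
    and slope: "\<And>t e. 0 \<le> t \<Longrightarrow> 0 < e \<Longrightarrow>
      \<forall>\<^sub>F s in at t within {0..}. \<bar>w s - w t\<bar> \<le> \<bar>s - t\<bar> * (C * w t + e)"
    and t: "0 \<le> t"
  shows "w t = 0"
proof -
  have cont: "continuous_on {0..} w"
    unfolding continuous_on_def
  proof
    fix t :: real assume t: "t \<in> {0..}"
    have "((\<lambda>s. w s - w t) \<longlongrightarrow> 0) (at t within {0..})"
    proof (rule Lim_null_comparison)
      show "\<forall>\<^sub>F s in at t within {0..}. norm (w s - w t) \<le> \<bar>s - t\<bar> * (C * w t + 1)"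
        using slope[of t 1] t by simp
      show "((\<lambda>s. \<bar>s - t\<bar> * (C * w t + 1)) \<longlongrightarrow> 0) (at t within {0..})"
        by (auto intro!: tendsto_eq_intros)
    qed
    then show "(w \<longlongrightarrow> w t) (at t within {0..})" by (simp add: LIM_zero_iff)
  qed
  have less: "w t < e * exp ((C + 1) * t)" if e: "0 < e" for e
  proof -
    define b where "b s = e * exp ((C + 1) * s)" for s
    have b_der: "(b has_real_derivative (C + 1) * b s) (at s)" for s
      unfolding b_def by (auto intro!: derivative_eq_intros)
    have "w t - b t < 0"
    proof (rule first_crossing[of "\<lambda>_. \<lambda>s. w s - b s" "{()}" "()"])
      show "continuous_on {0..} (\<lambda>s. w s - b s)"
        unfolding b_def by (intro continuous_intros cont)
      show "w 0 - b 0 < 0" using e init by (simp add: b_def)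
      fix r :: real assume r: "0 < r" and eq: "w r - b r = 0"
      define p where "p = b r"
      have p: "0 < p" using e by (simp add: p_def b_def)
      \<comment> \<open>The bound on the slope of \<open>w\<close> at the contact time \<open>r\<close>, with error \<open>p / 2\<close>, is smaller than the slope
          of the barrier \<open>b\<close>; hence \<open>w\<close> lies above \<open>b\<close> just before \<open>r\<close>.\<close>
      define h where "h s = p - (r - s) * (C * p + p / 2) - b s" for s
      have "(h has_real_derivative (C * p + p / 2) - (C + 1) * b r) (at r)"
        unfolding h_def by (auto intro!: derivative_eq_intros b_der)
      then have "\<forall>\<^sub>F s in at_left r. 0 < h s"
        by (rule eventually_at_left_pos_of_deriv_neg)
           (use p in \<open>simp_all add: h_def p_def algebra_simps\<close>)
      moreover have "\<forall>\<^sub>F s in at_left r. \<bar>w s - w r\<bar> \<le> \<bar>s - r\<bar> * (C * w r + p / 2)"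
      proof -
        have "at_left r \<le> at r within {0..}"
          using at_within_nonneg[OF r] by (simp add: at_le)
        moreover have "\<forall>\<^sub>F s in at r within {0..}. \<bar>w s - w r\<bar> \<le> \<bar>s - r\<bar> * (C * w r + p / 2)"
          using r p by (intro slope) auto
        ultimately show ?thesis by (rule filter_leD)
      qed
      moreover have "\<forall>\<^sub>F s in at_left r. s < r"
        by (simp add: eventually_at_filter)
      ultimately show "\<forall>\<^sub>F s in at_left r. 0 < w s - b s"
      proof eventually_elim
        case (elim s)
        have "w r = p" using eq by (simp add: p_def)
        then show ?case using elim by (simp add: h_def abs_le_iff)
      qed
    qed (use t in auto)
    then show ?thesis by (simp add: b_def)
  qed
  have "w t \<le> 0"
  proof (rule field_le_epsilon)
    fix e :: real assume "0 < e"
    show "w t \<le> 0 + e"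
      using less[of "e / exp ((C + 1) * t)"] \<open>0 < e\<close> by simp
  qed
  with nonneg[OF t] show ?thesis by simp
qed

section \<open>The frequency response function\<close>

text \<open>Here \<open>S\<close> is the domain of \<open>F\<close> and \<open>[a, b]\<close> the range in which all frequencies will turn out to lie.\<close>

locale frequency_law =
  fixes F :: "real \<Rightarrow> real" and S :: "real set" and a b m B :: real
  assumes S_open: "open S" and S_interval: "is_interval S"
    and a_less_b: "a < b" and ab_subset: "{a..b} \<subseteq> S"
    and F_deriv: "\<And>v. v \<in> S \<Longrightarrow> (F has_real_derivative deriv F v) (at v)"
    and F_deriv_pos: "\<And>v. v \<in> S \<Longrightarrow> 0 < deriv F v"
    and m_pos: "0 < m"
    and F_deriv_bounds: "\<And>v. v \<in> {a..b} \<Longrightarrow> m \<le> deriv F v \<and> deriv F v \<le> B"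
begin

lemma B_pos: "0 < B"
  using F_deriv_bounds[of a] m_pos a_less_b by auto

lemma F_strict_mono: "F v < F w" if "v \<in> S" "w \<in> S" "v < w"
proof (rule DERIV_pos_imp_increasing[OF that(3)])
  fix x assume "v \<le> x" "x \<le> w"
  then have "x \<in> S"
    by (rule mem_is_interval_1_I[OF S_interval that(1,2)])
  then show "\<exists>y. (F has_real_derivative y) (at x) \<and> 0 < y"
    using F_deriv F_deriv_pos by blast
qed

lemma F_less_iff: "F v < F w \<longleftrightarrow> v < w" if "v \<in> S" "w \<in> S"
  using F_strict_mono[of v w] F_strict_mono[of w v] that by (cases v w rule: linorder_cases) auto

lemma F_le_iff: "F v \<le> F w \<longleftrightarrow> v \<le> w" if "v \<in> S" "w \<in> S"
  using F_less_iff[OF that(2,1)] by (simp add: not_less[symmetric])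

lemma F_inj: "inj_on F S"
  by (metis F_le_iff inj_onI order_antisym order_refl)

lemma ab_in_S: "a \<in> S" "b \<in> S"
  using ab_subset a_less_b by auto

lemma frequency_in_range: "v \<in> {a..b}" if "v \<in> S" "F a \<le> F v" "F v \<le> F b"
  using that F_le_iff ab_in_S by auto

lemma F_expanding: "m * \<bar>v - w\<bar> \<le> \<bar>F v - F w\<bar>" if "v \<in> {a..b}" "w \<in> {a..b}"
proof -
  have *: "m * (y - x) \<le> F y - F x" if xy: "x \<in> {a..b}" "y \<in> {a..b}" "x < y" for x y
  proof -
    have "(F has_real_derivative deriv F z) (at z)" if "x \<le> z" "z \<le> y" for z
      using that xy ab_subset by (intro F_deriv) auto
    then obtain z where z: "x < z" "z < y" "F y - F x = (y - x) * deriv F z"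
      using MVT2[OF xy(3), of F "deriv F"] by blast
    have "m \<le> deriv F z" using F_deriv_bounds[of z] z xy by auto
    then show ?thesis
      using z xy mult_left_mono[of m "deriv F z" "y - x"] by (simp add: mult.commute)
  qed
  show ?thesis
    using *[of v w] *[of w v] that by (cases v w rule: linorder_cases) auto
qed

lemma F_dist_le: "\<bar>v - w\<bar> \<le> \<bar>F v - F w\<bar> / m" if "v \<in> {a..b}" "w \<in> {a..b}"
  using F_expanding[OF that] m_pos by (simp add: field_simps)

lemma F_isCont: "isCont F v" if "v \<in> S"
  using F_deriv[OF that] by (rule DERIV_isCont)

lemma F_onto: "\<exists>v\<in>{a..b}. F v = y" if "F a \<le> y" "y \<le> F b"
proof -
  have "\<forall>x. a \<le> x \<and> x \<le> b \<longrightarrow> isCont F x"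
    using F_isCont ab_subset by auto
  then show ?thesis
    using IVT[of F a y b] that a_less_b by auto
qed

text \<open>The frequency is given implicitly by \<open>F (\<omega> s) = r s\<close>; this is the chain rule for \<open>F\<^sup>-\<^sup>1 \<circ> r\<close>, stated
without naming the inverse.\<close>

lemma deriv_of_F_preimage:
  assumes r: "(r has_real_derivative r') (at t)"
    and eq: "\<forall>\<^sub>F s in nhds t. \<omega> s \<in> S \<and> F (\<omega> s) = r s"
  shows "(\<omega> has_real_derivative r' / deriv F (\<omega> t)) (at t)"
proof -
  define g where "g = the_inv_into S F"
  have \<omega>_t: "\<omega> t \<in> S" "F (\<omega> t) = r t"
    using eventually_nhds_x_imp_x[OF eq] by auto
  have "(g has_real_derivative inverse (deriv F (\<omega> t))) (at (F (\<omega> t)))"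
    unfolding has_field_derivative_def
  proof (rule has_derivative_inverse_strong[where f = F and S = S])
    show "(F has_derivative (*) (deriv F (\<omega> t))) (at (\<omega> t))"
      using F_deriv \<omega>_t by (simp add: has_field_derivative_def)
    show "(*) (deriv F (\<omega> t)) \<circ> (*) (inverse (deriv F (\<omega> t))) = id"
      using F_deriv_pos[OF \<omega>_t(1)] by (auto simp: fun_eq_iff)
    show "continuous_on S F"
      using F_isCont by (simp add: continuous_at_imp_continuous_on)
    show "g (F z) = z" if "z \<in> S" for z
      using the_inv_into_f_f[OF F_inj that] by (simp add: g_def)
  qed (use S_open \<omega>_t in auto)
  then have "((g \<circ> r) has_real_derivative inverse (deriv F (\<omega> t)) * r') (at t)"
    using DERIV_chain[of g _ r t r' UNIV] r \<omega>_t by simp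
  moreover have "\<forall>\<^sub>F s in nhds t. (g \<circ> r) s = \<omega> s"
    using eq
  proof eventually_elim
    case (elim s)
    then show ?case using the_inv_into_f_f[OF F_inj, of "\<omega> s"] by (simp add: g_def)
  qed
  ultimately have "(\<omega> has_real_derivative inverse (deriv F (\<omega> t)) * r') (at t)"
    by (simp cong: DERIV_cong_ev)
  then show ?thesis by (simp add: field_simps)
qed

end

section \<open>Phase locking and frequency synchronization on a finite lattice\<close>

lemma sin_add_le_sin_plus_sin:
  fixes x y :: real
  assumes "0 \<le> x" "x \<le> pi" "0 \<le> y" "y \<le> pi"
  shows "sin (x + y) \<le> sin x + sin y"
proof -
  have "sin x * cos y \<le> sin x" "sin y * cos x \<le> sin y"
    using assms by (simp_all add: mult_left_le sin_ge_zero)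
  then show ?thesis by (simp add: sin_add mult.commute)
qed

lemma abs_sin_diff_le: "\<bar>sin x - sin y\<bar> \<le> \<bar>x - y\<bar>" for x y :: real
proof (cases "x = y")
  case False
  have "\<exists>z. sin u - sin v = (u - v) * cos z" if "v < u" for u v :: real
    using MVT2[OF that, of sin cos] by (metis DERIV_sin)
  from this[of y x] this[of x y] False obtain z where "\<bar>sin x - sin y\<bar> = \<bar>x - y\<bar> * \<bar>cos z\<bar>"
    by (metis abs_minus_commute abs_mult linorder_neqE)
  then show ?thesis by (simp add: mult_left_le)
qed simp

text \<open>The lattice equation is assumed for positive times only. It extends to \<open>t = 0\<close> by continuity, see
\<open>frequency_eq\<close> below.\<close>

locale kuramoto_lattice = frequency_law F S a b m B
  for F S a b m B +
  fixes I :: "'i set" and \<kappa> a\<^sub>\<Phi> b\<^sub>\<Phi> \<theta>s :: real and \<nu> :: "'i \<Rightarrow> real" and \<phi> :: "'i \<Rightarrow> 'i \<Rightarrow> real"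
    and \<theta> \<omega> :: "'i \<Rightarrow> real \<Rightarrow> real"
  assumes finite_I: "finite I" and I_nonempty: "I \<noteq> {}"
    and \<kappa>_pos: "0 < \<kappa>" and a\<^sub>\<Phi>_pos: "0 < a\<^sub>\<Phi>"
    and \<theta>s: "0 < \<theta>s" "\<theta>s < pi / 2"
    and \<phi>_bounds: "\<And>i j. i \<in> I \<Longrightarrow> j \<in> I \<Longrightarrow> a\<^sub>\<Phi> \<le> \<phi> i j \<and> \<phi> i j \<le> b\<^sub>\<Phi>"
    and \<phi>_sym: "\<And>i j. i \<in> I \<Longrightarrow> j \<in> I \<Longrightarrow> \<phi> i j = \<phi> j i"
    and \<nu>_bounds: "\<And>i. i \<in> I \<Longrightarrow> F a + \<kappa> * b\<^sub>\<Phi> \<le> \<nu> i \<and> \<nu> i \<le> F b - \<kappa> * b\<^sub>\<Phi>"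
    and \<nu>_osc: "\<And>i j. i \<in> I \<Longrightarrow> j \<in> I \<Longrightarrow> \<nu> i - \<nu> j < \<kappa> * a\<^sub>\<Phi> * sin \<theta>s"
    and init_osc: "\<And>i j. i \<in> I \<Longrightarrow> j \<in> I \<Longrightarrow> \<theta> i 0 - \<theta> j 0 \<le> \<theta>s"
    and \<theta>_deriv: "\<And>i t. i \<in> I \<Longrightarrow> 0 \<le> t \<Longrightarrow> (\<theta> i has_real_derivative \<omega> i t) (at t within {0..})"
    and \<omega>_cont: "\<And>i. i \<in> I \<Longrightarrow> continuous_on {0..} (\<omega> i)"
    and \<omega>_S: "\<And>i t. i \<in> I \<Longrightarrow> 0 < t \<Longrightarrow> \<omega> i t \<in> S"
    and \<omega>_eq: "\<And>i t. i \<in> I \<Longrightarrow> 0 < t \<Longrightarrow>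
      F (\<omega> i t) = \<nu> i + \<kappa> / card I * (\<Sum>j\<in>I. \<phi> i j * sin (\<theta> j t - \<theta> i t))"
begin

definition force :: "'i \<Rightarrow> real \<Rightarrow> real" where
  "force i t = \<nu> i + \<kappa> / card I * (\<Sum>j\<in>I. \<phi> i j * sin (\<theta> j t - \<theta> i t))"

lemma card_pos: "0 < real (card I)"
  using finite_I I_nonempty by (simp add: card_gt_0_iff)

lemma \<theta>_cont: "i \<in> I \<Longrightarrow> continuous_on {0..} (\<theta> i)"
  by (rule DERIV_continuous_on[of _ _ "\<omega> i"]) (use \<theta>_deriv in auto)

lemma \<theta>_deriv_at: "i \<in> I \<Longrightarrow> 0 < t \<Longrightarrow> (\<theta> i has_real_derivative \<omega> i t) (at t)"
  using \<theta>_deriv[of i t] by (simp add: at_within_nonneg)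

text \<open>The margin \<open>\<kappa> b\<^sub>\<Phi>\<close> in the bounds on \<open>\<nu>\<close> is the largest possible size of the coupling term.\<close>

lemma force_range: "force i t \<in> {F a..F b}" if i: "i \<in> I"
proof -
  have "\<bar>\<Sum>j\<in>I. \<phi> i j * sin (\<theta> j t - \<theta> i t)\<bar> \<le> (\<Sum>j\<in>I. b\<^sub>\<Phi>)"
  proof (rule sum_abs[THEN order_trans], rule sum_mono)
    fix j assume "j \<in> I"
    then have "0 \<le> \<phi> i j" "\<phi> i j \<le> b\<^sub>\<Phi>" using \<phi>_bounds[OF i] a\<^sub>\<Phi>_pos by force+
    then show "\<bar>\<phi> i j * sin (\<theta> j t - \<theta> i t)\<bar> \<le> b\<^sub>\<Phi>"
      using mult_mono[of "\<phi> i j" b\<^sub>\<Phi> "\<bar>sin (\<theta> j t - \<theta> i t)\<bar>" 1] by (simp add: abs_mult)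
  qed
  then have "\<bar>\<kappa> / card I * (\<Sum>j\<in>I. \<phi> i j * sin (\<theta> j t - \<theta> i t))\<bar> \<le> \<kappa> * b\<^sub>\<Phi>"
    using card_pos \<kappa>_pos by (simp add: abs_mult field_simps)
  moreover have "F a + \<kappa> * b\<^sub>\<Phi> \<le> \<nu> i" "\<nu> i \<le> F b - \<kappa> * b\<^sub>\<Phi>"
    using \<nu>_bounds[OF i] by auto
  ultimately show ?thesis
    unfolding force_def atLeastAtMost_iff abs_le_iff by linarith
qed

lemma force_cont: "i \<in> I \<Longrightarrow> continuous_on {0..} (force i)"
  unfolding force_def by (intro continuous_intros \<theta>_cont)

lemma frequency_range: "\<omega> i t \<in> {a..b}" if i: "i \<in> I" and t: "0 \<le> t"
proof (cases "t = 0")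
  case False
  then show ?thesis
    using frequency_in_range[of "\<omega> i t"] \<omega>_S[OF i] \<omega>_eq[OF i] force_range[OF i, of t] t
    by (simp add: force_def)
next
  case True
  have "\<omega> i ` closure {0<..} \<subseteq> {a..b}"
  proof (rule image_closure_subset)
    show "continuous_on (closure {0<..}) (\<omega> i)"
      using \<omega>_cont[OF i] by simp
    show "\<omega> i ` {0<..} \<subseteq> {a..b}"
    proof safe
      fix s :: real assume "0 < s"
      then show "\<omega> i s \<in> {a..b}"
        using frequency_in_range[of "\<omega> i s"] \<omega>_S[OF i] \<omega>_eq[OF i] force_range[OF i, of s]
        by (simp add: force_def)
    qed
  qed simp
  then show ?thesis using True by (auto simp: image_subset_iff)
qed

lemma frequency_eq: "F (\<omega> i t) = force i t" if i: "i \<in> I" and t: "0 \<le> t"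
proof -
  have "continuous_on {0..} (\<lambda>s. F (\<omega> i s))"
  proof (rule continuous_on_compose2[OF _ \<omega>_cont[OF i]])
    show "continuous_on {a..b} F"
      using F_isCont ab_subset by (auto intro: continuous_at_imp_continuous_on)
  qed (use frequency_range[OF i] in auto)
  then have "continuous_on {0..} (\<lambda>s. F (\<omega> i s) - force i s)"
    by (intro continuous_intros force_cont i)
  moreover have "F (\<omega> i s) - force i s = 0" if "s \<in> {0<..}" for s
    using \<omega>_eq[OF i, of s] that by (simp add: force_def)
  ultimately have "F (\<omega> i t) - force i t = 0"
    using continuous_constant_on_closure[of "{0<..}" "\<lambda>s. F (\<omega> i s) - force i s" 0 t] t by simp
  then show ?thesis by simp
qed

text \<open>Let the phase diameter reach a value \<open>\<delta>\<close> slightly above \<open>\<theta>\<^sub>*\<close>, attained by the leading oscillator \<open>k\<close> and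
the last oscillator \<open>l\<close>. Every oscillator \<open>h\<close> lies between them and pulls them together with total
strength at least \<open>a\<^sub>\<Phi> (sin (\<theta>\<^sub>k - \<theta>\<^sub>h) + sin (\<theta>\<^sub>h - \<theta>\<^sub>l)) \<ge> a\<^sub>\<Phi> sin \<delta>\<close>. This exceeds the difference of their
natural frequencies divided by \<open>\<kappa>\<close>, so \<open>F\<close> of the frequency of \<open>k\<close> is smaller than that of \<open>l\<close>, and the
diameter decreases.\<close>

lemma phase_diff_le: "\<theta> i t - \<theta> j t \<le> \<theta>s" if i: "i \<in> I" and j: "j \<in> I" and t: "0 \<le> t"
proof -
  have less: "\<theta> i t - \<theta> j t < \<theta>s + e" if e: "0 < e" "\<theta>s + e < pi / 2" for e
  proof -
    define u where "u = (\<lambda>(k, l) s. \<theta> k s - \<theta> l s - (\<theta>s + e))"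
    define u' where "u' = (\<lambda>(k, l) s. \<omega> k s - \<omega> l s)"
    have "u (i, j) t < 0"
    proof (rule negative_of_deriv_neg_at_zeros[of u "I \<times> I" u'])
      show "finite (u ` (I \<times> I))" using finite_I by simp
      show "continuous_on {0..} (u p)" if "p \<in> I \<times> I" for p
        using that by (auto simp: u_def intro!: continuous_intros \<theta>_cont)
      show "u p 0 < 0" if "p \<in> I \<times> I" for p
        using that init_osc e by (fastforce simp: u_def)
      show "(u p has_real_derivative u' p s) (at s)" if "p \<in> I \<times> I" "0 < s" for p s
        using that by (auto simp: u_def u'_def intro!: derivative_eq_intros \<theta>_deriv_at)
    next
      fix p s assume "p \<in> I \<times> I" and s: "0 < s" and le: "\<And>q. q \<in> I \<times> I \<Longrightarrow> u q s \<le> 0"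
        and zero: "u p s = 0"
      then obtain k l where p: "p = (k, l)" "k \<in> I" "l \<in> I" by auto
      have kl: "\<theta> k s - \<theta> l s = \<theta>s + e" using zero p by (simp add: u_def)
      have top: "\<theta> h s \<le> \<theta> k s" and bot: "\<theta> l s \<le> \<theta> h s" if "h \<in> I" for h
        using le[of "(h, l)"] le[of "(k, h)"] that p kl by (auto simp: u_def)
      have "(\<Sum>h\<in>I. \<phi> k h * sin (\<theta> h s - \<theta> k s)) - (\<Sum>h\<in>I. \<phi> l h * sin (\<theta> h s - \<theta> l s))
          = - (\<Sum>h\<in>I. \<phi> k h * sin (\<theta> k s - \<theta> h s) + \<phi> l h * sin (\<theta> h s - \<theta> l s))"
      proof -
        have "sin (\<theta> h s - \<theta> k s) = - sin (\<theta> k s - \<theta> h s)" for h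
          by (metis minus_diff_eq sin_minus)
        then show ?thesis by (simp add: sum_subtractf sum.distrib sum_negf)
      qed
      moreover have "(\<Sum>h\<in>I. a\<^sub>\<Phi> * sin (\<theta>s + e))
          \<le> (\<Sum>h\<in>I. \<phi> k h * sin (\<theta> k s - \<theta> h s) + \<phi> l h * sin (\<theta> h s - \<theta> l s))"
      proof (rule sum_mono)
        fix h assume h: "h \<in> I"
        have range: "0 \<le> \<theta> k s - \<theta> h s" "\<theta> k s - \<theta> h s \<le> pi" "0 \<le> \<theta> h s - \<theta> l s" "\<theta> h s - \<theta> l s \<le> pi"
          using top[OF h] bot[OF h] kl e pi_gt_zero by linarith+
        have "a\<^sub>\<Phi> * sin (\<theta>s + e) \<le> a\<^sub>\<Phi> * (sin (\<theta> k s - \<theta> h s) + sin (\<theta> h s - \<theta> l s))"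
          using sin_add_le_sin_plus_sin[OF range] kl a\<^sub>\<Phi>_pos by (intro mult_left_mono) simp_all
        also have "\<dots> \<le> \<phi> k h * sin (\<theta> k s - \<theta> h s) + \<phi> l h * sin (\<theta> h s - \<theta> l s)"
          unfolding distrib_left
          using \<phi>_bounds p h range by (intro add_mono mult_right_mono sin_ge_zero) auto
        finally show "a\<^sub>\<Phi> * sin (\<theta>s + e)
            \<le> \<phi> k h * sin (\<theta> k s - \<theta> h s) + \<phi> l h * sin (\<theta> h s - \<theta> l s)" .
      qed
      ultimately have sums: "(\<Sum>h\<in>I. \<phi> k h * sin (\<theta> h s - \<theta> k s)) - (\<Sum>h\<in>I. \<phi> l h * sin (\<theta> h s - \<theta> l s))
          \<le> - (card I * (a\<^sub>\<Phi> * sin (\<theta>s + e)))"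
        by simp
      have "force k s - force l s = \<nu> k - \<nu> l + \<kappa> / card I *
          ((\<Sum>h\<in>I. \<phi> k h * sin (\<theta> h s - \<theta> k s)) - (\<Sum>h\<in>I. \<phi> l h * sin (\<theta> h s - \<theta> l s)))"
        by (simp add: force_def right_diff_distrib)
      also have "\<dots> \<le> \<nu> k - \<nu> l + \<kappa> / card I * - (card I * (a\<^sub>\<Phi> * sin (\<theta>s + e)))"
        using sums \<kappa>_pos by (intro add_left_mono mult_left_mono) auto
      also have "\<dots> = \<nu> k - \<nu> l - \<kappa> * a\<^sub>\<Phi> * sin (\<theta>s + e)"
        using card_pos by simp
      also have "\<dots> < \<kappa> * a\<^sub>\<Phi> * sin \<theta>s - \<kappa> * a\<^sub>\<Phi> * sin (\<theta>s + e)"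
        using \<nu>_osc p by simp
      also have "\<dots> \<le> 0"
        using sin_monotone_2pi_le[of \<theta>s "\<theta>s + e"] e \<theta>s \<kappa>_pos a\<^sub>\<Phi>_pos by simp
      finally have "F (\<omega> k s) < F (\<omega> l s)"
        using frequency_eq p s by simp
      then show "u' p s < 0"
        using F_less_iff[OF \<omega>_S \<omega>_S] p s by (simp add: u'_def)
    qed (use i j t in auto)
    then show ?thesis by (simp add: u_def)
  qed
  show ?thesis
  proof (rule dense_ge)
    fix y assume "\<theta>s < y"
    then have "\<theta> i t - \<theta> j t < \<theta>s + min (y - \<theta>s) ((pi / 2 - \<theta>s) / 2)"
      using \<theta>s by (intro less) (auto simp: min_def field_simps)
    then show "\<theta> i t - \<theta> j t \<le> y" by linarith
  qed
qed

text \<open>The derivative of the frequency, obtained by differentiating the lattice equation.\<close>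

definition accel :: "'i \<Rightarrow> real \<Rightarrow> real" where
  "accel i t = \<kappa> / card I * (\<Sum>j\<in>I. \<phi> i j * cos (\<theta> j t - \<theta> i t) * (\<omega> j t - \<omega> i t)) / deriv F (\<omega> i t)"

lemma \<omega>_deriv: "(\<omega> i has_real_derivative accel i t) (at t)" if i: "i \<in> I" and t: "0 < t"
  unfolding accel_def
proof (rule deriv_of_F_preimage)
  show "(force i has_real_derivative
      \<kappa> / card I * (\<Sum>j\<in>I. \<phi> i j * cos (\<theta> j t - \<theta> i t) * (\<omega> j t - \<omega> i t))) (at t)"
    unfolding force_def using i t
    by (auto intro!: derivative_eq_intros \<theta>_deriv_at sum.cong simp: mult_ac finite_I I_nonempty)
  have "\<forall>\<^sub>F s in nhds t. s \<in> {0<..}"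
    using t by (intro eventually_nhds_in_open) auto
  then show "\<forall>\<^sub>F s in nhds t. \<omega> i s \<in> S \<and> F (\<omega> i s) = force i s"
    by eventually_elim (use \<omega>_S[OF i] frequency_eq[OF i] in auto)
qed

text \<open>Half of the contraction rate \<open>\<kappa> a\<^sub>\<Phi> cos \<theta>\<^sub>* / B\<close> of the frequency spread. The barrier argument needs
a strict inequality, and giving away a factor two provides it.\<close>

definition rate :: real where
  "rate = \<kappa> * a\<^sub>\<Phi> * cos \<theta>s / (2 * B)"

lemma cos_\<theta>s_pos: "0 < cos \<theta>s"
  using \<theta>s by (intro cos_gt_zero) auto

lemma rate_pos: "0 < rate"
  using \<kappa>_pos a\<^sub>\<Phi>_pos cos_\<theta>s_pos B_pos by (simp add: rate_def)

lemma cos_phase_ge: "cos \<theta>s \<le> cos (\<theta> i t - \<theta> j t)" if "i \<in> I" "j \<in> I" "0 \<le> t"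
proof -
  have "\<bar>\<theta> i t - \<theta> j t\<bar> \<le> \<theta>s"
    using phase_diff_le[of i j t] phase_diff_le[of j i t] that by (simp add: abs_le_iff)
  then have "cos \<theta>s \<le> cos \<bar>\<theta> i t - \<theta> j t\<bar>"
    using \<theta>s pi_gt_zero by (intro cos_monotone_0_pi_le) auto
  then show ?thesis by simp
qed

text \<open>For an oscillator of extremal frequency (\<open>\<sigma> = 1\<close> for a maximum, \<open>\<sigma> = - 1\<close> for a minimum) all terms of the
sum in \<open>accel\<close> have the same sign, so that the weights can be replaced by their lower bounds and
\<open>deriv F\<close> by its upper bound.\<close>

lemma accel_le_at_max:
  assumes i: "i \<in> I" and t: "0 \<le> t" and top: "\<And>k. k \<in> I \<Longrightarrow> \<sigma> * (\<omega> k t - \<omega> i t) \<le> 0"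
  shows "\<sigma> * accel i t \<le> 2 * rate / card I * (\<Sum>k\<in>I. \<sigma> * (\<omega> k t - \<omega> i t))"
proof -
  define X where "X = (\<Sum>k\<in>I. \<sigma> * (\<omega> k t - \<omega> i t))"
  have X: "X \<le> 0" unfolding X_def by (rule sum_nonpos) (use top in auto)
  define f where "f = deriv F (\<omega> i t)"
  have f: "0 < f" "f \<le> B"
    using F_deriv_bounds[OF frequency_range[OF i t]] m_pos by (auto simp: f_def)
  have "\<sigma> * (\<Sum>k\<in>I. \<phi> i k * cos (\<theta> k t - \<theta> i t) * (\<omega> k t - \<omega> i t))
      = (\<Sum>k\<in>I. \<phi> i k * cos (\<theta> k t - \<theta> i t) * (\<sigma> * (\<omega> k t - \<omega> i t)))"
    by (simp add: sum_distrib_left mult_ac)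
  also have "\<dots> \<le> (\<Sum>k\<in>I. a\<^sub>\<Phi> * cos \<theta>s * (\<sigma> * (\<omega> k t - \<omega> i t)))"
  proof (rule sum_mono)
    fix k assume k: "k \<in> I"
    have "a\<^sub>\<Phi> * cos \<theta>s \<le> \<phi> i k * cos (\<theta> k t - \<theta> i t)"
      using \<phi>_bounds[OF i k] cos_phase_ge[OF k i t] a\<^sub>\<Phi>_pos cos_\<theta>s_pos by (intro mult_mono) auto
    then show "\<phi> i k * cos (\<theta> k t - \<theta> i t) * (\<sigma> * (\<omega> k t - \<omega> i t))
        \<le> a\<^sub>\<Phi> * cos \<theta>s * (\<sigma> * (\<omega> k t - \<omega> i t))"
      using top[OF k] by (rule mult_right_mono_neg)
  qed
  also have "\<dots> = a\<^sub>\<Phi> * cos \<theta>s * X" by (simp add: X_def sum_distrib_left)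
  finally have le: "\<sigma> * (\<Sum>k\<in>I. \<phi> i k * cos (\<theta> k t - \<theta> i t) * (\<omega> k t - \<omega> i t)) \<le> a\<^sub>\<Phi> * cos \<theta>s * X" .
  have "\<sigma> * accel i t = \<kappa> / card I *
      (\<sigma> * (\<Sum>k\<in>I. \<phi> i k * cos (\<theta> k t - \<theta> i t) * (\<omega> k t - \<omega> i t))) / f"
    by (simp add: accel_def f_def)
  also have "\<dots> \<le> \<kappa> / card I * (a\<^sub>\<Phi> * cos \<theta>s * X) / f"
    using le \<kappa>_pos f by (intro divide_right_mono mult_left_mono) auto
  also have "\<dots> \<le> \<kappa> / card I * (a\<^sub>\<Phi> * cos \<theta>s * X) / B"
  proof (rule divide_left_mono_neg)
    show "\<kappa> / card I * (a\<^sub>\<Phi> * cos \<theta>s * X) \<le> 0"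
      using \<kappa>_pos a\<^sub>\<Phi>_pos cos_\<theta>s_pos X by (intro mult_nonneg_nonpos) simp_all
  qed (use f B_pos in auto)
  also have "\<dots> = 2 * rate / card I * X"
    using B_pos by (simp add: rate_def mult_ac)
  finally show ?thesis by (simp add: X_def)
qed

text \<open>When the largest frequency difference touches the barrier, the sums in \<open>accel_le_at_max\<close> for its two
oscillators add up to minus the number of oscillators times that difference. The initial height
\<open>b - a + 1\<close> of the barrier strictly exceeds every difference of frequencies in \<open>[a, b]\<close>.\<close>

lemma frequency_diff_decay: "\<omega> i t - \<omega> j t \<le> (b - a + 1) * exp (- rate * t)"
  if i: "i \<in> I" and j: "j \<in> I" and t: "0 \<le> t"
proof -
  define E where "E s = (b - a + 1) * exp (- rate * s)" for s
  have E_pos: "0 < E s" for s using a_less_b by (simp add: E_def)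
  have E_der: "(E has_real_derivative - rate * E s) (at s)" for s
    unfolding E_def by (auto intro!: derivative_eq_intros)
  have E_cont: "continuous_on {0..} E"
    unfolding E_def by (intro continuous_intros)
  define u where "u = (\<lambda>(k, l) s. \<omega> k s - \<omega> l s - E s)"
  define u' where "u' = (\<lambda>(k, l) s. accel k s - accel l s + rate * E s)"
  have "u (i, j) t < 0"
  proof (rule negative_of_deriv_neg_at_zeros[of u "I \<times> I" u'])
    show "finite (u ` (I \<times> I))" using finite_I by simp
    show "continuous_on {0..} (u p)" if "p \<in> I \<times> I" for p
      using that by (auto simp: u_def intro!: continuous_intros \<omega>_cont E_cont)
    show "u p 0 < 0" if "p \<in> I \<times> I" for p
      using that frequency_range[of "fst p" 0] frequency_range[of "snd p" 0] by (auto simp: u_def E_def)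
    show "(u p has_real_derivative u' p s) (at s)" if "p \<in> I \<times> I" "0 < s" for p s
      using that by (auto simp: u_def u'_def intro!: derivative_eq_intros \<omega>_deriv E_der)
  next
    fix p s assume "p \<in> I \<times> I" and s: "0 < s" and le: "\<And>q. q \<in> I \<times> I \<Longrightarrow> u q s \<le> 0"
      and zero: "u p s = 0"
    then obtain k l where p: "p = (k, l)" "k \<in> I" "l \<in> I" by auto
    have kl: "\<omega> k s - \<omega> l s = E s" using zero p by (simp add: u_def)
    have top: "\<omega> h s \<le> \<omega> k s" and bot: "\<omega> l s \<le> \<omega> h s" if "h \<in> I" for h
      using le[of "(h, l)"] le[of "(k, h)"] that p kl by (auto simp: u_def)
    have "1 * accel k s \<le> 2 * rate / card I * (\<Sum>h\<in>I. 1 * (\<omega> h s - \<omega> k s))"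
      by (rule accel_le_at_max) (use p s top in auto)
    moreover have "-1 * accel l s \<le> 2 * rate / card I * (\<Sum>h\<in>I. -1 * (\<omega> h s - \<omega> l s))"
      by (rule accel_le_at_max) (use p s bot in auto)
    ultimately have "accel k s - accel l s \<le> 2 * rate / card I *
        ((\<Sum>h\<in>I. \<omega> h s - \<omega> k s) + (\<Sum>h\<in>I. \<omega> l s - \<omega> h s))"
      by (simp add: distrib_left)
    also have "(\<Sum>h\<in>I. \<omega> h s - \<omega> k s) + (\<Sum>h\<in>I. \<omega> l s - \<omega> h s) = - (card I * E s)"
      unfolding sum.distrib[symmetric] kl[symmetric] by (simp add: algebra_simps)
    also have "2 * rate / card I * - (card I * E s) = - (2 * rate * E s)"
      using card_pos by simp
    finally have "u' p s \<le> - (rate * E s)" using p by (simp add: u'_def algebra_simps)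
    then show "u' p s < 0"
      using mult_pos_pos[OF rate_pos E_pos[of s]] by linarith
  qed (use i j t in auto)
  then show ?thesis by (simp add: u_def E_def)
qed

text \<open>Symmetry of \<open>\<phi>\<close> makes the coupling antisymmetric under exchange of two oscillators.\<close>

lemma sum_force: "(\<Sum>i\<in>I. force i t) = (\<Sum>i\<in>I. \<nu> i)"
proof -
  define X where "X = (\<Sum>i\<in>I. \<Sum>j\<in>I. \<phi> i j * sin (\<theta> j t - \<theta> i t))"
  have "X = (\<Sum>i\<in>I. \<Sum>j\<in>I. \<phi> j i * sin (\<theta> i t - \<theta> j t))"
    unfolding X_def by (rule sum.swap)
  also have "\<dots> = (\<Sum>i\<in>I. \<Sum>j\<in>I. - (\<phi> i j * sin (\<theta> j t - \<theta> i t)))"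
  proof (intro sum.cong refl)
    fix i j assume "i \<in> I" "j \<in> I"
    moreover have "sin (\<theta> i t - \<theta> j t) = - sin (\<theta> j t - \<theta> i t)"
      by (metis minus_diff_eq sin_minus)
    ultimately show "\<phi> j i * sin (\<theta> i t - \<theta> j t) = - (\<phi> i j * sin (\<theta> j t - \<theta> i t))"
      using \<phi>_sym by simp
  qed
  also have "\<dots> = - X" by (simp add: X_def sum_negf)
  finally have "X = 0" by simp
  then show ?thesis
    unfolding force_def sum.distrib by (simp only: sum_distrib_left[symmetric] X_def[symmetric])
qed

text \<open>Since \<open>F c\<close> is the mean of the values of \<open>F\<close> at the frequencies, \<open>c\<close> lies between the smallest and
the largest frequency, and the spread bounds the distance to \<open>c\<close>. The constant does not depend on
the number of oscillators, and \<open>c\<close> depends on \<open>\<nu>\<close> through its mean only.\<close>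

lemma frequency_decay: "\<bar>\<omega> i t - c\<bar> \<le> (b - a + 1) * exp (- rate * t)"
  if c: "c \<in> {a..b}" "F c = (\<Sum>i\<in>I. \<nu> i) / card I" and i: "i \<in> I" and t: "0 \<le> t"
proof -
  have cS: "c \<in> S" using c ab_subset by auto
  have \<omega>S: "\<omega> j t \<in> S" if "j \<in> I" for j
    using frequency_range[OF that t] ab_subset by auto
  have sum: "(\<Sum>j\<in>I. F (\<omega> j t)) = (\<Sum>j\<in>I. F c)"
    using sum_force[of t] c card_pos frequency_eq t by simp
  have "\<exists>j\<in>I. \<omega> j t \<le> c"
  proof (rule ccontr)
    assume "\<not> ?thesis"
    then have "(\<Sum>j\<in>I. F c) < (\<Sum>j\<in>I. F (\<omega> j t))"
      using finite_I I_nonempty cS \<omega>S by (intro sum_strict_mono) (auto simp: F_less_iff not_le)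
    then show False using sum by simp
  qed
  moreover have "\<exists>j\<in>I. c \<le> \<omega> j t"
  proof (rule ccontr)
    assume "\<not> ?thesis"
    then have "(\<Sum>j\<in>I. F (\<omega> j t)) < (\<Sum>j\<in>I. F c)"
      using finite_I I_nonempty cS \<omega>S by (intro sum_strict_mono) (auto simp: F_less_iff not_le)
    then show False using sum by simp
  qed
  ultimately obtain j k where "j \<in> I" "\<omega> j t \<le> c" "k \<in> I" "c \<le> \<omega> k t" by blast
  then show ?thesis
    using frequency_diff_decay[OF i \<open>j \<in> I\<close> t] frequency_diff_decay[OF \<open>k \<in> I\<close> i t]
    by (simp add: abs_le_iff)
qed

end

section \<open>Dyadic cells and averages\<close>

text \<open>Completion preserves \<open>\<sigma>\<close>-finiteness; this is what makes the product of two completed Lebesgue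
measures, as it occurs in \<open>cell_mean2\<close>, accessible to the theory of product measures.\<close>

lemma sigma_finite_lebesgue: "sigma_finite_measure (lebesgue :: 'a::euclidean_space measure)"
proof
  obtain A :: "'a set set" where "countable A" "A \<subseteq> sets lborel" "\<Union>A = space lborel"
      "\<forall>a\<in>A. emeasure lborel a \<noteq> \<infinity>"
    using lborel.sigma_finite_countable by blast
  then show "\<exists>A::'a set set. countable A \<and> A \<subseteq> sets lebesgue \<and> \<Union>A = space lebesgue \<and>
      (\<forall>a\<in>A. emeasure lebesgue a \<noteq> \<infinity>)"
    by (intro exI[of _ A]) (auto simp: subset_iff)
qed

lemma pair_sigma_finite_lebesgue:
  "pair_sigma_finite (lebesgue :: 'a::euclidean_space measure) (lebesgue :: 'b::euclidean_space measure)"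
  by (intro pair_sigma_finite.intro sigma_finite_lebesgue)

text \<open>Borel measurable functions on the product space are measurable for the product of the completed
measures.\<close>

lemma measurable_ident_lebesgue_pair:
  "(\<lambda>z. z) \<in> (lebesgue :: 'a::euclidean_space measure) \<Otimes>\<^sub>M (lebesgue :: 'b::euclidean_space measure) \<rightarrow>\<^sub>M borel"
proof -
  have *: "(\<lambda>x::'c::euclidean_space. x) \<in> lebesgue \<rightarrow>\<^sub>M borel"
    by (simp add: measurable_completion)
  have "(\<lambda>z. (fst z, snd z)) \<in> (lebesgue :: 'a measure) \<Otimes>\<^sub>M (lebesgue :: 'b measure) \<rightarrow>\<^sub>M borel \<Otimes>\<^sub>M borel"
    by (intro measurable_Pair measurable_compose[OF measurable_fst *] measurable_compose[OF measurable_snd *])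
  then show ?thesis by (simp add: borel_prod)
qed

lemma set_integrable_bounded:
  fixes f :: "'a \<Rightarrow> real"
  assumes "set_borel_measurable M A f" "A \<in> sets M" "emeasure M A < \<infinity>"
    and bound: "\<And>x. x \<in> A \<Longrightarrow> \<bar>f x\<bar> \<le> c"
  shows "set_integrable M A f"
  unfolding set_integrable_def
proof (rule Bochner_Integration.integrable_bound)
  show "integrable M (\<lambda>x. indicator A x *\<^sub>R c)"
    using assms by simp
  show "(\<lambda>x. indicat_real A x *\<^sub>R f x) \<in> borel_measurable M"
    using assms(1) by (simp add: set_borel_measurable_def)
  show "AE x in M. norm (indicat_real A x *\<^sub>R f x) \<le> norm (indicat_real A x *\<^sub>R c)"
  proof (intro AE_I2)
    fix x show "norm (indicat_real A x *\<^sub>R f x) \<le> norm (indicat_real A x *\<^sub>R c)"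
      using bound[of x] by (cases "x \<in> A") auto
  qed
qed

lemma set_mean_bounds:
  fixes f :: "'a \<Rightarrow> real"
  assumes f: "set_borel_measurable M A f" and A: "A \<in> sets M" "emeasure M A < \<infinity>"
    and pos: "0 < measure M A" and bounds: "\<And>x. x \<in> A \<Longrightarrow> lo \<le> f x \<and> f x \<le> hi"
  shows "lo \<le> (LINT x:A|M. f x) / measure M A" "(LINT x:A|M. f x) / measure M A \<le> hi"
proof -
  have int: "set_integrable M A f"
    by (rule set_integrable_bounded[OF f A, of "max \<bar>lo\<bar> \<bar>hi\<bar>"]) (use bounds in \<open>force simp: abs_le_iff\<close>)
  have const: "set_integrable M A (\<lambda>_. c)" "(LINT x:A|M. c) = c * measure M A" for c :: real
    using A by (simp_all add: set_integrable_def set_lebesgue_integral_def)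
  have "lo * measure M A \<le> (LINT x:A|M. f x)"
    unfolding const(2)[symmetric] by (rule set_integral_mono[OF const(1) int]) (use bounds in auto)
  then show "lo \<le> (LINT x:A|M. f x) / measure M A"
    using pos by (simp add: field_simps)
  have "(LINT x:A|M. f x) \<le> hi * measure M A"
    unfolding const(2)[symmetric] by (rule set_integral_mono[OF int const(1)]) (use bounds in auto)
  then show "(LINT x:A|M. f x) / measure M A \<le> hi"
    using pos by (simp add: field_simps)
qed

locale dyadic_cells =
  fixes D :: "'a::euclidean_space set" and P :: "nat \<Rightarrow> nat \<Rightarrow> 'a set"
  assumes D_compact: "compact D" and D_pos: "0 < measure lebesgue D" and P: "dyadic_partitions D P"
begin

abbreviation \<mu> :: real where "\<mu> \<equiv> measure lebesgue D"

lemma D_lmeasurable: "D \<in> lmeasurable"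
  using D_compact by (rule lmeasurable_compact)

lemma D_sets: "D \<in> sets lebesgue"
  using D_lmeasurable by (rule fmeasurableD)

lemma D_nonempty: "D \<noteq> {}"
  using D_pos by auto

lemma P_sets: "\<alpha> \<in> {1..2^N} \<Longrightarrow> P N \<alpha> \<in> sets lebesgue"
  and P_cover: "(\<Union>\<alpha>\<in>{1..2^N}. P N \<alpha>) = D"
  and P_disjoint: "disjoint_family_on (P N) {1..2^N}"
  and P_diameter: "(\<lambda>N. Max ((\<lambda>\<alpha>. diameter (P N \<alpha>)) ` {1..2^N})) \<longlonglongrightarrow> 0"
  and P_split: "\<alpha> \<in> {1..2^N} \<Longrightarrow> P N \<alpha> = P (Suc N) (2 * \<alpha> - 1) \<union> P (Suc N) (2 * \<alpha>) \<and>
        P (Suc N) (2 * \<alpha> - 1) \<inter> P (Suc N) (2 * \<alpha>) = {} \<and>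
        measure lebesgue (P (Suc N) (2 * \<alpha> - 1)) = measure lebesgue (P (Suc N) (2 * \<alpha>))"
  using P unfolding dyadic_partitions_def by blast+

lemma P_subset: "\<alpha> \<in> {1..2^N} \<Longrightarrow> P N \<alpha> \<subseteq> D"
  using P_cover[of N] by blast

lemma P_lmeasurable: "\<alpha> \<in> {1..2^N} \<Longrightarrow> P N \<alpha> \<in> lmeasurable"
  using fmeasurableI2[OF D_lmeasurable P_subset P_sets] .

lemma P_finite: "\<alpha> \<in> {1..2^N} \<Longrightarrow> emeasure lebesgue (P N \<alpha>) < \<infinity>"
  using P_lmeasurable[of \<alpha> N] unfolding fmeasurable_def infinity_ennreal_def by blast

lemma P_measure: "\<alpha> \<in> {1..2^N} \<Longrightarrow> measure lebesgue (P N \<alpha>) = \<mu> / 2 ^ N"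
proof (induction N arbitrary: \<alpha>)
  case 0
  then have "\<alpha> = 1" by auto
  then show ?case using P by (simp add: dyadic_partitions_def)
next
  case (Suc N)
  \<comment> \<open>The index of the parent cell.\<close>
  define \<beta> where "\<beta> = (\<alpha> + 1) div 2"
  have \<beta>: "\<beta> \<in> {1..2^N}" "\<alpha> = 2 * \<beta> - 1 \<or> \<alpha> = 2 * \<beta>"
    using Suc.prems by (auto simp: \<beta>_def)
  then have children: "2 * \<beta> - 1 \<in> {1..2^Suc N}" "2 * \<beta> \<in> {1..2^Suc N}"
    by auto
  have "\<mu> / 2 ^ N = measure lebesgue (P (Suc N) (2 * \<beta> - 1)) + measure lebesgue (P (Suc N) (2 * \<beta>))"
    unfolding Suc.IH[OF \<beta>(1), symmetric]
    using P_split[OF \<beta>(1)] P_lmeasurable[OF children(1)] P_lmeasurable[OF children(2)]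
    by (metis measure_Un3 measure_empty diff_zero)
  then show ?case
    using P_split[OF \<beta>(1)] \<beta>(2) by auto
qed

lemma P_measure_pos: "\<alpha> \<in> {1..2^N} \<Longrightarrow> 0 < measure lebesgue (P N \<alpha>)"
  using P_measure D_pos by simp

lemma P_small:
  assumes "0 < e"
  shows "\<forall>\<^sub>F N in sequentially. \<forall>\<alpha>\<in>{1..2^N}. \<forall>x\<in>P N \<alpha>. \<forall>y\<in>P N \<alpha>. dist x y < e"
  using order_tendstoD(2)[OF P_diameter assms]
proof eventually_elim
  case (elim N)
  show ?case
  proof (intro ballI)
    fix \<alpha> x y assume \<alpha>: "\<alpha> \<in> {1..2^N}" and xy: "x \<in> P N \<alpha>" "y \<in> P N \<alpha>"
    have "dist x y \<le> diameter (P N \<alpha>)"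
      using diameter_bounded_bound xy bounded_subset[OF compact_imp_bounded[OF D_compact] P_subset[OF \<alpha>]]
      by blast
    also have "\<dots> \<le> Max ((\<lambda>\<alpha>. diameter (P N \<alpha>)) ` {1..2^N})"
      using \<alpha> by (intro Max_ge) auto
    also have "\<dots> < e" by (rule elim)
    finally show "dist x y < e" .
  qed
qed

definition cell :: "nat \<Rightarrow> 'a \<Rightarrow> nat" where
  "cell N x = (THE \<alpha>. \<alpha> \<in> {1..2^N} \<and> x \<in> P N \<alpha>)"

lemma cell_eq: "cell N x = \<alpha>" if "\<alpha> \<in> {1..2^N}" "x \<in> P N \<alpha>"
  unfolding cell_def
proof (rule the_equality)
  show "\<beta> = \<alpha>" if "\<beta> \<in> {1..2^N} \<and> x \<in> P N \<beta>" for \<beta>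
    using disjoint_family_onD[OF P_disjoint[of N], of \<alpha> \<beta>] that \<open>\<alpha> \<in> _\<close> \<open>x \<in> P N \<alpha>\<close>
    by blast
qed (use that in auto)

lemma cell_mem: "cell N x \<in> {1..2^N}" "x \<in> P N (cell N x)" if x: "x \<in> D"
proof -
  obtain \<alpha> where "\<alpha> \<in> {1..2^N}" "x \<in> P N \<alpha>" using x P_cover[of N] by blast
  then show "cell N x \<in> {1..2^N}" "x \<in> P N (cell N x)" using cell_eq by metis+
qed

lemma indicator_sum_eq_cell:
  assumes x: "x \<in> D"
  shows "(\<Sum>\<alpha>\<in>{1..2^N}. h \<alpha> * indicator (P N \<alpha>) x) = (h (cell N x) :: real)"
proof -
  have "(\<Sum>\<alpha>\<in>{1..2^N}. h \<alpha> * indicator (P N \<alpha>) x)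
      = (\<Sum>\<alpha>\<in>{1..2^N}. if \<alpha> = cell N x then h \<alpha> else 0)"
  proof (intro sum.cong refl)
    fix \<alpha> :: nat assume \<alpha>: "\<alpha> \<in> {1..2^N}"
    have "x \<in> P N \<alpha> \<longleftrightarrow> \<alpha> = cell N x" using cell_eq[OF \<alpha>] cell_mem[OF x] by metis
    then show "h \<alpha> * indicator (P N \<alpha>) x = (if \<alpha> = cell N x then h \<alpha> else 0)" by auto
  qed
  then show ?thesis using cell_mem(1)[OF x, of N] by simp
qed

lemma P_sets_lebesgue_on: "\<alpha> \<in> {1..2^N} \<Longrightarrow> P N \<alpha> \<in> sets (lebesgue_on D)"
  using P_sets P_subset D_sets by (simp add: sets_restrict_space_iff)

lemma step_measurable: "(\<lambda>x. h (cell N x) :: real) \<in> borel_measurable (lebesgue_on D)"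
proof (subst measurable_lebesgue_cong)
  show "x \<in> D \<Longrightarrow> h (cell N x) = (\<Sum>\<alpha>\<in>{1..2^N}. h \<alpha> * indicator (P N \<alpha>) x)" for x
    by (rule indicator_sum_eq_cell[symmetric])
  show "(\<lambda>x. \<Sum>\<alpha>\<in>{1..2^N}. h \<alpha> * indicator (P N \<alpha>) x) \<in> borel_measurable (lebesgue_on D)"
    by (intro borel_measurable_sum borel_measurable_times borel_measurable_const
        borel_measurable_indicator P_sets_lebesgue_on)
qed

sublocale lebesgue_D: finite_measure "lebesgue_on D"
  using D_lmeasurable by (rule finite_measure_lebesgue_on)

lemma measure_lebesgue_on_D: "measure (lebesgue_on D) (space (lebesgue_on D)) = \<mu>"
  using D_sets by (simp add: measure_restrict_space)

lemma emeasure_lebesgue_on_D: "emeasure (lebesgue_on D) (space (lebesgue_on D)) \<noteq> 0"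
  using measure_lebesgue_on_D D_pos by (auto simp: measure_def)

text \<open>The mean over \<open>D\<close>. The continuum equation with \<open>avg\<close> takes the place of the lattice equation with the
mean over all oscillators.\<close>

definition avg :: "('a \<Rightarrow> real) \<Rightarrow> real" where
  "avg f = (LINT z:D|lebesgue. f z) / \<mu>"

lemma avg_eq: "avg f = integral\<^sup>L (lebesgue_on D) f / \<mu>"
  using D_sets by (simp add: avg_def set_lebesgue_integral_def integral_restrict_space)

lemma avg_abs_le:
  assumes f: "f \<in> borel_measurable (lebesgue_on D)" and c: "AE x in lebesgue_on D. \<bar>f x\<bar> \<le> c"
  shows "\<bar>avg f\<bar> \<le> c"
proof -
  have int: "integrable (lebesgue_on D) f"
    by (rule lebesgue_D.integrable_const_bound[OF _ f]) (use c in simp)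
  have "\<bar>integral\<^sup>L (lebesgue_on D) f\<bar> \<le> (LINT x|lebesgue_on D. \<bar>f x\<bar>)"
    by (rule integral_abs_bound)
  also have "\<dots> \<le> (LINT x|lebesgue_on D. c)"
    by (rule integral_mono_AE) (use int c in auto)
  also have "\<dots> = c * \<mu>" using measure_lebesgue_on_D by simp
  finally show ?thesis using D_pos by (simp add: avg_eq field_simps)
qed

lemma avg_diff_le:
  assumes f: "f \<in> borel_measurable (lebesgue_on D)" "AE x in lebesgue_on D. \<bar>f x\<bar> \<le> K"
    and g: "g \<in> borel_measurable (lebesgue_on D)" "AE x in lebesgue_on D. \<bar>g x\<bar> \<le> K"
    and c: "AE x in lebesgue_on D. \<bar>f x - g x\<bar> \<le> c"
  shows "\<bar>avg f - avg g\<bar> \<le> c"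
proof -
  have "integrable (lebesgue_on D) f" "integrable (lebesgue_on D) g"
    using lebesgue_D.integrable_const_bound[of f K] lebesgue_D.integrable_const_bound[of g K] f g
    by simp_all
  then have "avg f - avg g = avg (\<lambda>x. f x - g x)"
    by (simp add: avg_eq diff_divide_distrib)
  also have "\<bar>\<dots>\<bar> \<le> c"
    by (rule avg_abs_le) (use f g c in auto)
  finally show ?thesis .
qed

text \<open>The bridge between lattice and continuum: means over cells are integrals of step functions, which
can be compared across levels.\<close>

lemma sum_cells_eq_avg: "(\<Sum>\<alpha>\<in>{1..2^N}. h \<alpha>) / 2 ^ N = avg (\<lambda>x. h (cell N x))"
proof -
  have "integral\<^sup>L (lebesgue_on D) (\<lambda>x. h (cell N x))
      = (LINT x|lebesgue_on D. (\<Sum>\<alpha>\<in>{1..2^N}. h \<alpha> * indicator (P N \<alpha>) x))"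
    by (rule Bochner_Integration.integral_cong) (simp_all only: space_lebesgue_on indicator_sum_eq_cell)
  also have "\<dots> = (\<Sum>\<alpha>\<in>{1..2^N}. LINT x|lebesgue_on D. h \<alpha> * indicator (P N \<alpha>) x)"
    by (rule Bochner_Integration.integral_sum)
       (simp add: lebesgue_D.emeasure_finite P_sets_lebesgue_on less_top[symmetric])
  also have "\<dots> = (\<Sum>\<alpha>\<in>{1..2^N}. h \<alpha> * (\<mu> / 2 ^ N))"
  proof (intro sum.cong refl)
    fix \<alpha> :: nat assume \<alpha>: "\<alpha> \<in> {1..2^N}"
    have "(LINT x|lebesgue_on D. indicat_real (P N \<alpha>) x) = measure (lebesgue_on D) (P N \<alpha>)"
      using P_sets_lebesgue_on[OF \<alpha>] P_subset[OF \<alpha>] by (simp add: Int_absorb2)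
    then show "(LINT x|lebesgue_on D. h \<alpha> * indicator (P N \<alpha>) x) = h \<alpha> * (\<mu> / 2 ^ N)"
      using P_measure[OF \<alpha>] P_subset[OF \<alpha>] D_sets by (simp add: measure_restrict_space)
  qed
  finally show ?thesis
    using D_pos by (simp only: avg_eq sum_distrib_right[symmetric]) simp
qed

lemma set_borel_measurable_cell:
  fixes f :: "'a \<Rightarrow> real"
  assumes "continuous_on D f" "A \<in> sets lebesgue" "A \<subseteq> D"
  shows "set_borel_measurable lebesgue A f"
proof -
  have "f \<in> borel_measurable (lebesgue_on D)"
    using assms(1) D_sets by (rule continuous_imp_measurable_on_sets_lebesgue)
  then have "set_borel_measurable lebesgue D f"
    using D_sets by (simp add: set_borel_measurable_def borel_measurable_restrict_space_iff)
  then show ?thesis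
    using assms by (auto intro: set_borel_measurable_subset)
qed

lemma set_integrable_cell:
  fixes f :: "'a \<Rightarrow> real"
  assumes f: "continuous_on D f" and \<alpha>: "\<alpha> \<in> {1..2^N}"
  shows "set_integrable lebesgue (P N \<alpha>) f"
proof -
  have "bounded (f ` D)"
    using D_compact f by (intro compact_imp_bounded compact_continuous_image)
  then obtain c where "\<And>x. x \<in> D \<Longrightarrow> \<bar>f x\<bar> \<le> c"
    by (auto simp: bounded_iff)
  moreover have "set_borel_measurable lebesgue (P N \<alpha>) f"
    using set_borel_measurable_cell[OF f P_sets P_subset] \<alpha> by blast
  ultimately show ?thesis
    using P_subset[OF \<alpha>] P_sets[OF \<alpha>] P_lmeasurable[OF \<alpha>]
    by (intro set_integrable_bounded[of _ _ _ c]) (auto simp: fmeasurable_def)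
qed

lemma cell_mean_eq: "\<alpha> \<in> {1..2^N} \<Longrightarrow>
    cell_mean D N (P N \<alpha>) f = (LINT x:P N \<alpha>|lebesgue. f x) / measure lebesgue (P N \<alpha>)"
  using P_measure[of \<alpha> N] D_pos by (simp add: cell_mean_def)

lemma cell_mean_bounds:
  assumes f: "continuous_on D f" and \<alpha>: "\<alpha> \<in> {1..2^N}"
    and "\<And>x. x \<in> P N \<alpha> \<Longrightarrow> lo \<le> f x \<and> f x \<le> hi"
  shows "lo \<le> cell_mean D N (P N \<alpha>) f \<and> cell_mean D N (P N \<alpha>) f \<le> hi"
proof -
  have "set_borel_measurable lebesgue (P N \<alpha>) f"
    using set_borel_measurable_cell[OF f P_sets P_subset] \<alpha> by blast
  then show ?thesis
    unfolding cell_mean_eq[OF \<alpha>]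
    using set_mean_bounds[OF _ P_sets[OF \<alpha>] P_finite[OF \<alpha>] P_measure_pos[OF \<alpha>], of f lo hi]
      assms(3) by blast
qed

lemma sum_cell_mean:
  assumes f: "continuous_on D f"
  shows "(\<Sum>\<alpha>\<in>{1..2^N}. cell_mean D N (P N \<alpha>) f) / 2 ^ N = avg f"
proof -
  have "(LINT z:(\<Union>\<alpha>\<in>{1..2^N}. P N \<alpha>)|lebesgue. f z) = (\<Sum>\<alpha>\<in>{1..2^N}. LINT z:P N \<alpha>|lebesgue. f z)"
    by (rule set_integral_finite_Union) (use P_disjoint set_integrable_cell[OF f] P_sets in auto)
  then have "(LINT z:D|lebesgue. f z) = (\<Sum>\<alpha>\<in>{1..2^N}. LINT z:P N \<alpha>|lebesgue. f z)"
    by (simp only: P_cover)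
  then show ?thesis
    by (simp add: avg_def cell_mean_def sum_divide_distrib sum_distrib_left[symmetric])
qed

lemma indicator_product_measurable:
  fixes \<phi> :: "'a \<Rightarrow> 'a \<Rightarrow> real"
  assumes \<phi>: "continuous_on (D \<times> D) (\<lambda>(x, y). \<phi> x y)"
    and A: "A \<in> sets lebesgue" "A \<subseteq> D" and B: "B \<in> sets lebesgue" "B \<subseteq> D"
  shows "set_borel_measurable (lebesgue \<Otimes>\<^sub>M lebesgue) (A \<times> B) (\<lambda>z. \<phi> (fst z) (snd z))"
proof -
  have closed: "closed (D \<times> D)"
    using D_compact by (intro closed_Times compact_imp_closed)
  have "(\<lambda>z. indicator (D \<times> D) z *\<^sub>R \<phi> (fst z) (snd z)) \<in> borel_measurable borel"
    using \<phi> closed by (intro borel_measurable_continuous_on_indicator) (auto simp: case_prod_beta)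
  from measurable_compose[OF measurable_ident_lebesgue_pair this]
  have "set_borel_measurable (lebesgue \<Otimes>\<^sub>M lebesgue) (D \<times> D) (\<lambda>z. \<phi> (fst z) (snd z))"
    by (simp add: set_borel_measurable_def)
  then show ?thesis
    using A B by (auto intro: set_borel_measurable_subset)
qed

lemma emeasure_lebesgue_Times:
  assumes "A \<in> sets lebesgue" "B \<in> sets lebesgue"
  shows "emeasure (lebesgue \<Otimes>\<^sub>M lebesgue) ((A :: 'a set) \<times> (B :: 'a set)) = emeasure lebesgue A * emeasure lebesgue B"
  by (rule sigma_finite_measure.emeasure_pair_measure_Times[OF sigma_finite_lebesgue assms])

lemma cell_mean2_bounds:
  fixes \<phi> :: "'a \<Rightarrow> 'a \<Rightarrow> real"
  assumes \<phi>: "continuous_on (D \<times> D) (\<lambda>(x, y). \<phi> x y)" and \<alpha>: "\<alpha> \<in> {1..2^N}" and \<beta>: "\<beta> \<in> {1..2^N}"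
    and bounds: "\<And>x y. x \<in> P N \<alpha> \<Longrightarrow> y \<in> P N \<beta> \<Longrightarrow> lo \<le> \<phi> x y \<and> \<phi> x y \<le> hi"
  shows "lo \<le> cell_mean2 D N (P N \<alpha>) (P N \<beta>) \<phi> \<and> cell_mean2 D N (P N \<alpha>) (P N \<beta>) \<phi> \<le> hi"
proof -
  let ?M = "lebesgue \<Otimes>\<^sub>M (lebesgue :: 'a measure)" and ?A = "P N \<alpha> \<times> P N \<beta>"
  have em: "emeasure ?M ?A = emeasure lebesgue (P N \<alpha>) * emeasure lebesgue (P N \<beta>)"
    by (rule emeasure_lebesgue_Times) (use P_sets \<alpha> \<beta> in auto)
  have fin: "emeasure ?M ?A < \<infinity>"
    unfolding em using P_finite[OF \<alpha>] P_finite[OF \<beta>]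
    by (simp only: ennreal_mult_less_top infinity_ennreal_def) blast
  have m: "measure ?M ?A = (\<mu> / 2 ^ N)\<^sup>2"
    using em P_measure[OF \<alpha>] P_measure[OF \<beta>]
    by (simp add: measure_def enn2real_mult power2_eq_square)
  have "cell_mean2 D N (P N \<alpha>) (P N \<beta>) \<phi> = (LINT z:?A|?M. \<phi> (fst z) (snd z)) / measure ?M ?A"
    by (simp add: cell_mean2_def m power_divide power_mult[symmetric] mult.commute)
  moreover have "0 < measure ?M ?A" using D_pos by (simp add: m)
  moreover have "set_borel_measurable ?M ?A (\<lambda>z. \<phi> (fst z) (snd z))"
    by (rule indicator_product_measurable[OF \<phi>]) (use P_sets P_subset \<alpha> \<beta> in auto)
  moreover have "?A \<in> sets ?M"
    using P_sets \<alpha> \<beta> by (intro pair_measureI) auto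
  ultimately show ?thesis
    using set_mean_bounds[of ?M ?A "\<lambda>z. \<phi> (fst z) (snd z)" lo hi] fin bounds by auto
qed

lemma cell_mean2_sym:
  fixes \<phi> :: "'a \<Rightarrow> 'a \<Rightarrow> real"
  assumes \<phi>: "continuous_on (D \<times> D) (\<lambda>(x, y). \<phi> x y)" and \<alpha>: "\<alpha> \<in> {1..2^N}" and \<beta>: "\<beta> \<in> {1..2^N}"
    and sym: "\<And>x y. x \<in> D \<Longrightarrow> y \<in> D \<Longrightarrow> \<phi> x y = \<phi> y x"
  shows "cell_mean2 D N (P N \<alpha>) (P N \<beta>) \<phi> = cell_mean2 D N (P N \<beta>) (P N \<alpha>) \<phi>"
proof -
  interpret pair_sigma_finite "lebesgue :: 'a measure" "lebesgue :: 'a measure"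
    by (rule pair_sigma_finite_lebesgue)
  let ?M = "lebesgue \<Otimes>\<^sub>M (lebesgue :: 'a measure)"
  define f where "f z = indicator (P N \<alpha> \<times> P N \<beta>) z *\<^sub>R \<phi> (fst z) (snd z)" for z
  have "f \<in> borel_measurable ?M"
    using indicator_product_measurable[OF \<phi> P_sets[OF \<alpha>] P_subset[OF \<alpha>] P_sets[OF \<beta>] P_subset[OF \<beta>]]
    by (simp add: set_borel_measurable_def f_def[abs_def])
  from integral_product_swap[OF this]
  have "integral\<^sup>L ?M f = (LINT (x, y)|?M. f (y, x))" by simp
  also have "\<dots> = (LINT z|?M. indicator (P N \<beta> \<times> P N \<alpha>) z *\<^sub>R \<phi> (fst z) (snd z))"
  proof (rule Bochner_Integration.integral_cong[OF refl])
    fix z :: "'a \<times> 'a"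
    show "(case z of (x, y) \<Rightarrow> f (y, x)) = indicator (P N \<beta> \<times> P N \<alpha>) z *\<^sub>R \<phi> (fst z) (snd z)"
      using P_subset[OF \<alpha>] P_subset[OF \<beta>] sym by (cases z) (auto simp: f_def split: split_indicator)
  qed
  finally show ?thesis
    by (simp add: cell_mean2_def set_lebesgue_integral_def f_def[abs_def])
qed

lemma continuous_bdd:
  fixes f :: "'a \<Rightarrow> real"
  assumes "continuous_on D f"
  shows "bdd_above (f ` D)" "bdd_below (f ` D)"
  using compact_imp_bounded[OF compact_continuous_image[OF assms D_compact]]
  by (rule bounded_imp_bdd_above, rule bounded_imp_bdd_below)

lemma cell_mean_diff_le_osc:
  assumes f: "continuous_on D f" and \<alpha>: "\<alpha> \<in> {1..2^N}" and \<beta>: "\<beta> \<in> {1..2^N}"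
  shows "cell_mean D N (P N \<alpha>) f - cell_mean D N (P N \<beta>) f \<le> osc D f"
proof -
  have "(INF x\<in>D. f x) \<le> cell_mean D N (P N \<gamma>) f \<and> cell_mean D N (P N \<gamma>) f \<le> (SUP x\<in>D. f x)"
    if \<gamma>: "\<gamma> \<in> {1..2^N}" for \<gamma>
  proof (rule cell_mean_bounds[OF f \<gamma>])
    fix x assume "x \<in> P N \<gamma>"
    then have "x \<in> D" using P_subset[OF \<gamma>] by blast
    then show "(INF x\<in>D. f x) \<le> f x \<and> f x \<le> (SUP x\<in>D. f x)"
      using continuous_bdd[OF f] by (auto intro: cINF_lower cSUP_upper)
  qed
  from this[OF \<alpha>] this[OF \<beta>] show ?thesis by (simp add: osc_def)
qed

lemma cell_mean_approx:
  assumes f: "continuous_on D f" and e: "0 < e"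
  shows "\<forall>\<^sub>F N in sequentially. \<forall>x\<in>D. \<bar>cell_mean D N (P N (cell N x)) f - f x\<bar> \<le> e"
proof -
  obtain d where d: "0 < d" "\<And>x y. x \<in> D \<Longrightarrow> y \<in> D \<Longrightarrow> dist y x < d \<Longrightarrow> dist (f y) (f x) < e"
    using compact_uniformly_continuous[OF f D_compact] e unfolding uniformly_continuous_on_def by metis
  show ?thesis
    using P_small[OF d(1)]
  proof eventually_elim
    case (elim N)
    show ?case
    proof
      fix x assume x: "x \<in> D"
      have "f x - e \<le> cell_mean D N (P N (cell N x)) f \<and> cell_mean D N (P N (cell N x)) f \<le> f x + e"
      proof (rule cell_mean_bounds[OF f cell_mem(1)[OF x]])
        fix y assume y: "y \<in> P N (cell N x)"
        have "dist (f y) (f x) < e"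
          using elim cell_mem[OF x, of N] y subsetD[OF P_subset[OF cell_mem(1)[OF x]] y] x
          by (intro d(2)) auto
        then show "f x - e \<le> f y \<and> f y \<le> f x + e" by (auto simp: dist_real_def)
      qed
      then show "\<bar>cell_mean D N (P N (cell N x)) f - f x\<bar> \<le> e" by (simp add: abs_le_iff)
    qed
  qed
qed

lemma cell_mean2_approx:
  fixes \<phi> :: "'a \<Rightarrow> 'a \<Rightarrow> real"
  assumes \<phi>: "continuous_on (D \<times> D) (\<lambda>(x, y). \<phi> x y)" and e: "0 < e"
  shows "\<forall>\<^sub>F N in sequentially. \<forall>x\<in>D. \<forall>y\<in>D.
    \<bar>cell_mean2 D N (P N (cell N x)) (P N (cell N y)) \<phi> - \<phi> x y\<bar> \<le> e"
proof -
  have "uniformly_continuous_on (D \<times> D) (\<lambda>(x, y). \<phi> x y)"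
    using \<phi> D_compact by (intro compact_uniformly_continuous compact_Times)
  then obtain d where d: "0 < d" "\<And>p q. p \<in> D \<times> D \<Longrightarrow> q \<in> D \<times> D \<Longrightarrow> dist q p < d \<Longrightarrow>
      dist (case q of (x, y) \<Rightarrow> \<phi> x y) (case p of (x, y) \<Rightarrow> \<phi> x y) < e"
    using e unfolding uniformly_continuous_on_def by metis
  have "0 < d / 2" using d by simp
  from P_small[OF this] show ?thesis
  proof eventually_elim
    case (elim N)
    show ?case
    proof (intro ballI)
      fix x y assume x: "x \<in> D" and y: "y \<in> D"
      have "\<phi> x y - e \<le> cell_mean2 D N (P N (cell N x)) (P N (cell N y)) \<phi> \<and> cell_mean2 D N (P N (cell N x)) (P N (cell N y)) \<phi> \<le> \<phi> x y + e"
      proof (rule cell_mean2_bounds[OF \<phi> cell_mem(1)[OF x] cell_mem(1)[OF y]])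
        fix x' y' assume x': "x' \<in> P N (cell N x)" and y': "y' \<in> P N (cell N y)"
        have "x' \<in> D" "y' \<in> D"
          using x' y' P_subset[OF cell_mem(1)[OF x]] P_subset[OF cell_mem(1)[OF y]] by auto
        moreover have "dist x' x < d / 2" "dist y' y < d / 2"
          using elim cell_mem[OF x, of N] cell_mem[OF y, of N] x' y' by auto
        then have "dist (x', y') (x, y) < d"
          using sqrt_sum_squares_le_sum[of "dist x' x" "dist y' y"] by (simp add: dist_Pair_Pair)
        ultimately have "dist (\<phi> x' y') (\<phi> x y) < e"
          using d(2)[of "(x, y)" "(x', y')"] x y by simp
        then show "\<phi> x y - e \<le> \<phi> x' y' \<and> \<phi> x' y' \<le> \<phi> x y + e" by (auto simp: dist_real_def)
      qed
      then show "\<bar>cell_mean2 D N (P N (cell N x)) (P N (cell N y)) \<phi> - \<phi> x y\<bar> \<le> e" by (simp add: abs_le_iff)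
    qed
  qed
qed

end

section \<open>Uniform convergence of the lattice solutions\<close>

lemma coupling_measurable [measurable (raw)]:
  assumes "p \<in> borel_measurable M" "u \<in> borel_measurable M"
  shows "(\<lambda>z. p z * sin (u z - u0) :: real) \<in> borel_measurable M"
proof -
  have "(\<lambda>z. sin (u z - u0)) \<in> borel_measurable M"
    by (rule borel_measurable_continuous_on[of sin]) (use assms in \<open>auto intro: continuous_intros\<close>)
  then show ?thesis using assms by simp
qed

text \<open>The data, together with a solution of the lattice model at every level; \<open>\<Omega>\<close> are its frequencies.\<close>

locale kuramoto_continuum = frequency_law F S a b m B + dyadic_cells D P
  for F S a b m B and D :: "'a::euclidean_space set" and P +
  fixes \<kappa> a\<^sub>\<Phi> b\<^sub>\<Phi> \<theta>s :: real and \<nu> \<theta>0 :: "'a \<Rightarrow> real" and \<phi> :: "'a \<Rightarrow> 'a \<Rightarrow> real"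
    and \<Theta> \<Omega> :: "nat \<Rightarrow> nat \<Rightarrow> real \<Rightarrow> real"
  assumes \<kappa>_pos: "0 < \<kappa>" and a\<^sub>\<Phi>_pos: "0 < a\<^sub>\<Phi>"
    and \<theta>s: "0 < \<theta>s" "\<theta>s < pi / 2"
    and \<nu>_cont: "continuous_on D \<nu>" and \<phi>_cont: "continuous_on (D \<times> D) (\<lambda>(x, y). \<phi> x y)"
    and \<theta>0_cont: "continuous_on D \<theta>0"
    and \<phi>_bounds: "\<And>x y. x \<in> D \<Longrightarrow> y \<in> D \<Longrightarrow> a\<^sub>\<Phi> \<le> \<phi> x y \<and> \<phi> x y \<le> b\<^sub>\<Phi>"
    and \<phi>_sym: "\<And>x y. x \<in> D \<Longrightarrow> y \<in> D \<Longrightarrow> \<phi> x y = \<phi> y x"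
    and \<nu>_bounds: "\<And>x. x \<in> D \<Longrightarrow> F a + \<kappa> * b\<^sub>\<Phi> \<le> \<nu> x \<and> \<nu> x \<le> F b - \<kappa> * b\<^sub>\<Phi>"
    and \<nu>_osc: "osc D \<nu> < \<kappa> * a\<^sub>\<Phi> * sin \<theta>s" and \<theta>0_osc: "osc D \<theta>0 \<le> \<theta>s"
    and \<Theta>_init: "\<And>N \<alpha>. 1 \<le> N \<Longrightarrow> \<alpha> \<in> {1..2^N} \<Longrightarrow> \<Theta> N \<alpha> 0 = cell_mean D N (P N \<alpha>) \<theta>0"
    and \<Theta>_deriv: "\<And>N \<alpha> t. 1 \<le> N \<Longrightarrow> \<alpha> \<in> {1..2^N} \<Longrightarrow> 0 \<le> t \<Longrightarrow>
      (\<Theta> N \<alpha> has_real_derivative \<Omega> N \<alpha> t) (at t within {0..})"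
    and \<Omega>_cont: "\<And>N \<alpha>. 1 \<le> N \<Longrightarrow> \<alpha> \<in> {1..2^N} \<Longrightarrow> continuous_on {0..} (\<Omega> N \<alpha>)"
    and \<Omega>_S: "\<And>N \<alpha> t. 1 \<le> N \<Longrightarrow> \<alpha> \<in> {1..2^N} \<Longrightarrow> 0 < t \<Longrightarrow> \<Omega> N \<alpha> t \<in> S"
    and \<Omega>_eq: "\<And>N \<alpha> t. 1 \<le> N \<Longrightarrow> \<alpha> \<in> {1..2^N} \<Longrightarrow> 0 < t \<Longrightarrow> F (\<Omega> N \<alpha> t) =
      cell_mean D N (P N \<alpha>) \<nu> + \<kappa> / 2 ^ N *
        (\<Sum>\<beta>\<in>{1..2^N}. cell_mean2 D N (P N \<alpha>) (P N \<beta>) \<phi> * sin (\<Theta> N \<beta> t - \<Theta> N \<alpha> t))"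
begin

lemma b\<^sub>\<Phi>_pos: "0 < b\<^sub>\<Phi>"
  using D_nonempty \<phi>_bounds a\<^sub>\<Phi>_pos by force

lemma lattice:
  assumes N: "1 \<le> N"
  shows "kuramoto_lattice F S a b m B {1..2^N} \<kappa> a\<^sub>\<Phi> b\<^sub>\<Phi> \<theta>s (\<lambda>\<alpha>. cell_mean D N (P N \<alpha>) \<nu>)
    (\<lambda>\<alpha> \<beta>. cell_mean2 D N (P N \<alpha>) (P N \<beta>) \<phi>) (\<Theta> N) (\<Omega> N)"
proof (unfold_locales)
  fix \<alpha> \<beta> :: nat assume \<alpha>: "\<alpha> \<in> {1..2^N}" and \<beta>: "\<beta> \<in> {1..2^N}"
  show "a\<^sub>\<Phi> \<le> cell_mean2 D N (P N \<alpha>) (P N \<beta>) \<phi> \<and> cell_mean2 D N (P N \<alpha>) (P N \<beta>) \<phi> \<le> b\<^sub>\<Phi>"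
    by (rule cell_mean2_bounds[OF \<phi>_cont \<alpha> \<beta>]) (use \<phi>_bounds P_subset[OF \<alpha>] P_subset[OF \<beta>] in blast)
  show "cell_mean2 D N (P N \<alpha>) (P N \<beta>) \<phi> = cell_mean2 D N (P N \<beta>) (P N \<alpha>) \<phi>"
    using \<phi>_cont \<alpha> \<beta> \<phi>_sym by (rule cell_mean2_sym)
  show "cell_mean D N (P N \<alpha>) \<nu> - cell_mean D N (P N \<beta>) \<nu> < \<kappa> * a\<^sub>\<Phi> * sin \<theta>s"
    using cell_mean_diff_le_osc[OF \<nu>_cont \<alpha> \<beta>] \<nu>_osc by simp
  show "\<Theta> N \<alpha> 0 - \<Theta> N \<beta> 0 \<le> \<theta>s"
    using cell_mean_diff_le_osc[OF \<theta>0_cont \<alpha> \<beta>] \<theta>0_osc \<Theta>_init[OF N] \<alpha> \<beta> by simp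
next
  fix \<alpha> :: nat assume \<alpha>: "\<alpha> \<in> {1..2^N}"
  show "F a + \<kappa> * b\<^sub>\<Phi> \<le> cell_mean D N (P N \<alpha>) \<nu> \<and> cell_mean D N (P N \<alpha>) \<nu> \<le> F b - \<kappa> * b\<^sub>\<Phi>"
    by (rule cell_mean_bounds[OF \<nu>_cont \<alpha>]) (use \<nu>_bounds P_subset[OF \<alpha>] in blast)
  fix t :: real assume "0 < t"
  then show "F (\<Omega> N \<alpha> t) = cell_mean D N (P N \<alpha>) \<nu> + \<kappa> / real (card {1..2^N::nat}) *
      (\<Sum>\<beta>\<in>{1..2^N}. cell_mean2 D N (P N \<alpha>) (P N \<beta>) \<phi> * sin (\<Theta> N \<beta> t - \<Theta> N \<alpha> t))"
    using \<Omega>_eq[OF N \<alpha>] by simp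
qed (use \<kappa>_pos a\<^sub>\<Phi>_pos \<theta>s \<Theta>_deriv[OF N] \<Omega>_cont[OF N] \<Omega>_S[OF N] in auto)

text \<open>The solution and the data of level \<open>N\<close> as step functions. They are defined at every point of \<open>D\<close>, so
that all limits below can be taken pointwise.\<close>

definition \<theta>N :: "nat \<Rightarrow> real \<Rightarrow> 'a \<Rightarrow> real" where "\<theta>N N t x = \<Theta> N (cell N x) t"
definition \<omega>N :: "nat \<Rightarrow> real \<Rightarrow> 'a \<Rightarrow> real" where "\<omega>N N t x = \<Omega> N (cell N x) t"
definition \<nu>N :: "nat \<Rightarrow> 'a \<Rightarrow> real" where "\<nu>N N x = cell_mean D N (P N (cell N x)) \<nu>"
definition \<phi>N :: "nat \<Rightarrow> 'a \<Rightarrow> 'a \<Rightarrow> real" where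
  "\<phi>N N x y = cell_mean2 D N (P N (cell N x)) (P N (cell N y)) \<phi>"

lemma \<theta>N_measurable [measurable]: "\<theta>N N t \<in> borel_measurable (lebesgue_on D)"
  unfolding \<theta>N_def by (rule step_measurable)

lemma \<phi>N_measurable [measurable]: "\<phi>N N x \<in> borel_measurable (lebesgue_on D)"
  unfolding \<phi>N_def by (rule step_measurable)

lemma \<phi>_measurable: "x \<in> D \<Longrightarrow> \<phi> x \<in> borel_measurable (lebesgue_on D)"
proof (rule continuous_imp_measurable_on_sets_lebesgue[OF _ D_sets])
  assume x: "x \<in> D"
  have "continuous_on D (\<lambda>y. (x, y))" by (intro continuous_intros)
  from continuous_on_compose2[OF \<phi>_cont this] show "continuous_on D (\<phi> x)"
    using x by (simp add: image_subset_iff)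
qed

lemma \<omega>N_range: "1 \<le> N \<Longrightarrow> x \<in> D \<Longrightarrow> 0 \<le> t \<Longrightarrow> \<omega>N N t x \<in> {a..b}"
  unfolding \<omega>N_def using kuramoto_lattice.frequency_range[OF lattice] cell_mem(1) by blast

lemma \<theta>N_deriv: "1 \<le> N \<Longrightarrow> x \<in> D \<Longrightarrow> 0 \<le> t \<Longrightarrow>
    ((\<lambda>s. \<theta>N N s x) has_real_derivative \<omega>N N t x) (at t within {0..})"
  unfolding \<theta>N_def \<omega>N_def using \<Theta>_deriv cell_mem(1) by blast

lemma \<theta>N_cont: "1 \<le> N \<Longrightarrow> x \<in> D \<Longrightarrow> continuous_on {0..} (\<lambda>s. \<theta>N N s x)"
  by (rule DERIV_continuous_on[of _ _ "\<lambda>t. \<omega>N N t x"]) (use \<theta>N_deriv in auto)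

lemma \<theta>N_deriv_at: "1 \<le> N \<Longrightarrow> x \<in> D \<Longrightarrow> 0 < t \<Longrightarrow>
    ((\<lambda>s. \<theta>N N s x) has_real_derivative \<omega>N N t x) (at t)"
  using \<theta>N_deriv[of N x t] by (simp add: at_within_nonneg)

lemma \<omega>N_eq: "F (\<omega>N N t x) = \<nu>N N x + \<kappa> * avg (\<lambda>z. \<phi>N N x z * sin (\<theta>N N t z - \<theta>N N t x))"
  if N: "1 \<le> N" and x: "x \<in> D" and t: "0 \<le> t"
proof -
  interpret kuramoto_lattice F S a b m B "{1..2^N}" \<kappa> a\<^sub>\<Phi> b\<^sub>\<Phi> \<theta>s "\<lambda>\<alpha>. cell_mean D N (P N \<alpha>) \<nu>"
    "\<lambda>\<alpha> \<beta>. cell_mean2 D N (P N \<alpha>) (P N \<beta>) \<phi>" "\<Theta> N" "\<Omega> N"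
    by (rule lattice[OF N])
  show ?thesis
    using frequency_eq[OF cell_mem(1)[OF x, of N] t]
      sum_cells_eq_avg[where N = N and h = "\<lambda>\<beta>. cell_mean2 D N (P N (cell N x)) (P N \<beta>) \<phi> *
        sin (\<Theta> N \<beta> t - \<Theta> N (cell N x) t)"]
    unfolding force_def \<omega>N_def \<nu>N_def \<phi>N_def \<theta>N_def by (simp flip: times_divide_eq_right)
qed

text \<open>The rate of synchronization of the lattices, written without reference to a level.\<close>

definition \<rho> :: real where "\<rho> = \<kappa> * a\<^sub>\<Phi> * cos \<theta>s / (2 * B)"

lemma \<rho>_pos: "0 < \<rho>"
  using \<kappa>_pos a\<^sub>\<Phi>_pos B_pos \<theta>s by (simp add: \<rho>_def cos_gt_zero)

text \<open>The common asymptotic frequency of all lattices.\<close>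

definition c where "c = (SOME c. c \<in> {a..b} \<and> F c = avg \<nu>)"

lemma c: "c \<in> {a..b}" "F c = avg \<nu>"
proof -
  \<comment> \<open>The mean of \<open>\<nu>\<close> is the mean of its cell averages at any level, here the first one, and these obey
      the bounds of the lattice model.\<close>
  have N: "1 \<le> (1::nat)" by simp
  interpret l: kuramoto_lattice F S a b m B "{1..2^1}" \<kappa> a\<^sub>\<Phi> b\<^sub>\<Phi> \<theta>s "\<lambda>\<alpha>. cell_mean D 1 (P 1 \<alpha>) \<nu>"
    "\<lambda>\<alpha> \<beta>. cell_mean2 D 1 (P 1 \<alpha>) (P 1 \<beta>) \<phi>" "\<Theta> 1" "\<Omega> 1"
    by (rule lattice[OF N])
  have "F a \<le> cell_mean D 1 (P 1 \<alpha>) \<nu> \<and> cell_mean D 1 (P 1 \<alpha>) \<nu> \<le> F b" if "\<alpha> \<in> {1..2^1}" for \<alpha>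
  proof -
    have "0 < \<kappa> * b\<^sub>\<Phi>" using \<kappa>_pos b\<^sub>\<Phi>_pos by simp
    then show ?thesis using l.\<nu>_bounds[OF that] by linarith
  qed
  from this[of 1] this[of 2] have "F a \<le> avg \<nu> \<and> avg \<nu> \<le> F b"
    unfolding sum_cell_mean[OF \<nu>_cont, of 1, symmetric] by (simp add: numeral_2_eq_2)
  then have "\<exists>c. c \<in> {a..b} \<and> F c = avg \<nu>"
    using F_onto by blast
  from someI_ex[OF this] show "c \<in> {a..b}" "F c = avg \<nu>"
    by (simp_all add: c_def)
qed

lemma \<omega>N_decay: "\<bar>\<omega>N N t x - c\<bar> \<le> (b - a + 1) * exp (- \<rho> * t)"
  if N: "1 \<le> N" and x: "x \<in> D" and t: "0 \<le> t"
proof -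
  interpret kuramoto_lattice F S a b m B "{1..2^N}" \<kappa> a\<^sub>\<Phi> b\<^sub>\<Phi> \<theta>s "\<lambda>\<alpha>. cell_mean D N (P N \<alpha>) \<nu>"
    "\<lambda>\<alpha> \<beta>. cell_mean2 D N (P N \<alpha>) (P N \<beta>) \<phi>" "\<Theta> N" "\<Omega> N"
    by (rule lattice[OF N])
  show ?thesis
    using frequency_decay[OF c(1) _ cell_mem(1)[OF x, of N] t] c(2) sum_cell_mean[OF \<nu>_cont, of N]
    by (simp add: \<omega>N_def \<rho>_def rate_def)
qed

lemma \<phi>N_bounds: "1 \<le> N \<Longrightarrow> x \<in> D \<Longrightarrow> y \<in> D \<Longrightarrow> \<bar>\<phi>N N x y\<bar> \<le> b\<^sub>\<Phi>"
  using kuramoto_lattice.\<phi>_bounds[OF lattice, of N "cell N x" "cell N y"] cell_mem(1)[of x N] cell_mem(1)[of y N]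
    a\<^sub>\<Phi>_pos by (force simp: \<phi>N_def)

lemma \<phi>_abs_le: "x \<in> D \<Longrightarrow> y \<in> D \<Longrightarrow> \<bar>\<phi> x y\<bar> \<le> b\<^sub>\<Phi>"
  using \<phi>_bounds[of x y] a\<^sub>\<Phi>_pos by auto

lemma data_approx:
  assumes "0 < e"
  shows "\<forall>\<^sub>F N in sequentially. 1 \<le> N \<and> (\<forall>x\<in>D. \<bar>\<nu>N N x - \<nu> x\<bar> \<le> e \<and> \<bar>\<theta>N N 0 x - \<theta>0 x\<bar> \<le> e \<and>
    (\<forall>y\<in>D. \<bar>\<phi>N N x y - \<phi> x y\<bar> \<le> e))"
  using eventually_ge_at_top[of 1] cell_mean_approx[OF \<nu>_cont assms] cell_mean_approx[OF \<theta>0_cont assms]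
    cell_mean2_approx[OF \<phi>_cont assms]
proof eventually_elim
  case (elim N)
  have "\<theta>N N 0 x = cell_mean D N (P N (cell N x)) \<theta>0" if "x \<in> D" for x
    using \<Theta>_init[OF elim(1) cell_mem(1)[OF that]] by (simp add: \<theta>N_def)
  then show ?case using elim by (auto simp: \<nu>N_def \<phi>N_def)
qed

lemma coupling_abs_le: "\<bar>p * sin y\<bar> \<le> b\<^sub>\<Phi>" if "\<bar>p\<bar> \<le> b\<^sub>\<Phi>" for p y :: real
  using mult_mono[of "\<bar>p\<bar>" b\<^sub>\<Phi> "\<bar>sin y\<bar>" 1] that by (simp add: abs_mult)

lemma avg_coupling_abs_le:
  assumes "p \<in> borel_measurable (lebesgue_on D)" "u \<in> borel_measurable (lebesgue_on D)"
    and "\<And>z. z \<in> D \<Longrightarrow> \<bar>p z\<bar> \<le> b\<^sub>\<Phi>"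
  shows "\<bar>avg (\<lambda>z. p z * sin (u z - u0))\<bar> \<le> b\<^sub>\<Phi>"
  by (rule avg_abs_le[OF coupling_measurable[OF assms(1,2)]])
     (use assms(3) coupling_abs_le in \<open>auto intro!: AE_I2\<close>)

text \<open>The basic perturbation estimate of the coupling. It compares two levels, a level with its limit,
two times, two points of \<open>D\<close>, or two classical solutions; only the last case requires the bound on
\<open>u - v\<close> to be an almost everywhere bound.\<close>

lemma avg_coupling_diff_le:
  assumes p: "p \<in> borel_measurable (lebesgue_on D)" "\<And>z. z \<in> D \<Longrightarrow> \<bar>p z\<bar> \<le> b\<^sub>\<Phi>"
    and q: "q \<in> borel_measurable (lebesgue_on D)" "\<And>z. z \<in> D \<Longrightarrow> \<bar>q z\<bar> \<le> b\<^sub>\<Phi>"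
    and u: "u \<in> borel_measurable (lebesgue_on D)" and v: "v \<in> borel_measurable (lebesgue_on D)"
    and pq: "\<And>z. z \<in> D \<Longrightarrow> \<bar>p z - q z\<bar> \<le> e"
    and uv: "AE z in lebesgue_on D. \<bar>u z - v z\<bar> \<le> d"
  shows "\<bar>avg (\<lambda>z. p z * sin (u z - u0)) - avg (\<lambda>z. q z * sin (v z - v0))\<bar>
    \<le> e + b\<^sub>\<Phi> * (d + \<bar>u0 - v0\<bar>)"
proof (rule avg_diff_le[of _ b\<^sub>\<Phi>])
  show "AE z in lebesgue_on D. \<bar>p z * sin (u z - u0) - q z * sin (v z - v0)\<bar>
      \<le> e + b\<^sub>\<Phi> * (d + \<bar>u0 - v0\<bar>)"
    using uv AE_space
  proof eventually_elim
    case (elim z)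
    then have z: "z \<in> D" by simp
    have "\<bar>p z * sin (u z - u0) - q z * sin (v z - v0)\<bar>
        = \<bar>(p z - q z) * sin (u z - u0) + q z * (sin (u z - u0) - sin (v z - v0))\<bar>"
      by (simp add: algebra_simps)
    also have "\<dots> \<le> \<bar>p z - q z\<bar> * \<bar>sin (u z - u0)\<bar> + \<bar>q z\<bar> * \<bar>sin (u z - u0) - sin (v z - v0)\<bar>"
      by (rule abs_triangle_ineq[THEN order_trans]) (simp add: abs_mult)
    also have "\<dots> \<le> e * 1 + b\<^sub>\<Phi> * (d + \<bar>u0 - v0\<bar>)"
    proof (intro add_mono mult_mono)
      have "\<bar>sin (u z - u0) - sin (v z - v0)\<bar> \<le> \<bar>(u z - u0) - (v z - v0)\<bar>"
        by (rule abs_sin_diff_le)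
      also have "\<dots> \<le> d + \<bar>u0 - v0\<bar>" using elim by linarith
      finally show "\<bar>sin (u z - u0) - sin (v z - v0)\<bar> \<le> d + \<bar>u0 - v0\<bar>" .
      show "0 \<le> e" using pq[OF z] by simp
    qed (use p q pq z b\<^sub>\<Phi>_pos in auto)
    finally show ?case by simp
  qed
qed (use p q u v coupling_abs_le in \<open>auto intro!: AE_I2 coupling_measurable\<close>)

text \<open>A perturbation \<open>e\<close> of \<open>\<nu>\<close> and \<open>\<phi>\<close> together with phase differences of size \<open>r\<close> changes a frequency by at
most \<open>K e + C r\<close>. The summand \<open>1\<close> makes \<open>K e\<close> also a bound for a perturbation \<open>e\<close> of the initial phases.\<close>

definition K :: real where "K = 1 + (1 + \<kappa>) / m"
definition C :: real where "C = 2 * \<kappa> * b\<^sub>\<Phi> / m"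

lemma K_ge_1: "1 \<le> K" and C_nonneg: "0 \<le> C"
  using \<kappa>_pos b\<^sub>\<Phi>_pos m_pos by (simp_all add: K_def C_def)

text \<open>The hypotheses have the shape of the lattice and the continuum equations, with \<open>f\<close> and \<open>f'\<close> the averaged
coupling terms, and of the conclusion of \<open>avg_coupling_diff_le\<close>.\<close>

lemma frequency_diff_le:
  assumes v: "v \<in> {a..b}" "F v = n + \<kappa> * f" and w: "w \<in> {a..b}" "F w = n' + \<kappa> * f'"
    and n: "\<bar>n - n'\<bar> \<le> e" and f: "\<bar>f - f'\<bar> \<le> e + b\<^sub>\<Phi> * d" and d: "d \<le> 2 * r" and e: "0 \<le> e"
  shows "\<bar>v - w\<bar> \<le> K * e + C * r"
proof -
  have "F v - F w = (n - n') + \<kappa> * (f - f')"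
    by (simp add: v w algebra_simps)
  then have "\<bar>F v - F w\<bar> \<le> \<bar>n - n'\<bar> + \<kappa> * \<bar>f - f'\<bar>"
    using abs_triangle_ineq[of "n - n'" "\<kappa> * (f - f')"] \<kappa>_pos by (simp add: abs_mult)
  also have "\<dots> \<le> e + \<kappa> * (e + b\<^sub>\<Phi> * (2 * r))"
    using n f d \<kappa>_pos b\<^sub>\<Phi>_pos by (intro add_mono mult_left_mono) (auto intro: order_trans)
  finally have "\<bar>v - w\<bar> \<le> (e + \<kappa> * (e + b\<^sub>\<Phi> * (2 * r))) / m"
    using F_dist_le[OF v(1) w(1)] m_pos by (meson divide_right_mono less_imp_le order_trans)
  also have "\<dots> = (1 + \<kappa>) / m * e + C * r"
    by (simp add: C_def field_simps add_divide_distrib)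
  also have "\<dots> \<le> K * e + C * r"
    using e by (simp add: K_def algebra_simps)
  finally show ?thesis .
qed

text \<open>Although \<open>x\<close> ranges over \<open>D\<close>, only finitely many differences \<open>\<Theta> N \<alpha> - \<Theta> M \<beta>\<close> occur, so the Gronwall
inequality for finite families applies.\<close>

lemma finite_time_stability:
  assumes N: "1 \<le> N" and M: "1 \<le> M" and e: "0 \<le> e"
    and data: "\<And>x. x \<in> D \<Longrightarrow> \<bar>\<nu>N N x - \<nu>N M x\<bar> \<le> e" "\<And>x. x \<in> D \<Longrightarrow> \<bar>\<theta>N N 0 x - \<theta>N M 0 x\<bar> \<le> e"
      "\<And>x y. x \<in> D \<Longrightarrow> y \<in> D \<Longrightarrow> \<bar>\<phi>N N x y - \<phi>N M x y\<bar> \<le> e"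
    and x: "x \<in> D" and t: "0 \<le> t"
  shows "\<bar>\<theta>N N t x - \<theta>N M t x\<bar> \<le> K * e * exp ((C + 1) * t)"
proof (rule gronwall_finite_family[of "\<lambda>x t. \<theta>N N t x - \<theta>N M t x" D "\<lambda>x t. \<omega>N N t x - \<omega>N M t x",
      OF _ _ _ _ _ C_nonneg x t])
  have "(\<lambda>x t. \<theta>N N t x - \<theta>N M t x) ` D
      \<subseteq> (\<lambda>(\<alpha>, \<beta>) t. \<Theta> N \<alpha> t - \<Theta> M \<beta> t) ` ({1..2^N} \<times> {1..2^M})"
  proof
    fix f assume "f \<in> (\<lambda>x t. \<theta>N N t x - \<theta>N M t x) ` D"
    then obtain x where "x \<in> D" "f = (\<lambda>t. \<Theta> N (cell N x) t - \<Theta> M (cell M x) t)"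
      by (auto simp: \<theta>N_def)
    then show "f \<in> (\<lambda>(\<alpha>, \<beta>) t. \<Theta> N \<alpha> t - \<Theta> M \<beta> t) ` ({1..2^N} \<times> {1..2^M})"
      using cell_mem(1) by (intro image_eqI[of _ _ "(cell N x, cell M x)"]) auto
  qed
  then show "finite ((\<lambda>x t. \<theta>N N t x - \<theta>N M t x) ` D)"
    by (rule finite_subset) simp
next
  fix x s r assume x: "x \<in> D" and s: "0 < s" and r: "\<And>y. y \<in> D \<Longrightarrow> \<bar>\<theta>N N s y - \<theta>N M s y\<bar> \<le> r"
  have s0: "0 \<le> s" using s by simp
  show "\<bar>\<omega>N N s x - \<omega>N M s x\<bar> \<le> K * e + C * r"
  proof (rule frequency_diff_le[OF \<omega>N_range[OF N x s0] \<omega>N_eq[OF N x s0] \<omega>N_range[OF M x s0] \<omega>N_eq[OF M x s0]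
        data(1)[OF x] avg_coupling_diff_le])
    show "AE z in lebesgue_on D. \<bar>\<theta>N N s z - \<theta>N M s z\<bar> \<le> r" using r by (auto intro!: AE_I2)
    show "r + \<bar>\<theta>N N s x - \<theta>N M s x\<bar> \<le> 2 * r" using r[OF x] by simp
  qed (use \<phi>N_bounds N M x data(3) e in auto)
next
  fix x assume x: "x \<in> D"
  show "\<bar>\<theta>N N 0 x - \<theta>N M 0 x\<bar> \<le> K * e"
    using data(2)[OF x] mult_right_mono[OF K_ge_1 e] by simp
qed (use N M \<theta>N_cont \<theta>N_deriv_at in \<open>auto intro!: continuous_intros derivative_eq_intros\<close>)

text \<open>Both frequencies are close to the same \<open>c\<close>, so their difference is integrable up to \<open>t = \<infinity>\<close>. In
place of an integral, the proof uses the monotonicity of the difference plus the primitive of the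
bound.\<close>

lemma tail_stability:
  assumes N: "1 \<le> N" and M: "1 \<le> M" and x: "x \<in> D" and T: "0 < T" "T \<le> t"
  shows "\<bar>\<theta>N N t x - \<theta>N M t x\<bar> \<le> \<bar>\<theta>N N T x - \<theta>N M T x\<bar> + 2 * (b - a + 1) / \<rho> * exp (- \<rho> * T)"
proof -
  define R where "R = b - a + 1"
  have R: "0 < R" using a_less_b by (simp add: R_def)
  have one_sided: "\<sigma> * (\<theta>N N t x - \<theta>N M t x) \<le> \<sigma> * (\<theta>N N T x - \<theta>N M T x) + 2 * R / \<rho> * exp (- \<rho> * T)"
    if \<sigma>: "\<bar>\<sigma>\<bar> = 1" for \<sigma>
  proof -
    \<comment> \<open>The bound \<open>2 R exp (- \<rho> s)\<close> for the derivative of the difference has the primitive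
        \<open>- 2 R / \<rho> exp (- \<rho> s)\<close>.\<close>
    define g where "g s = \<sigma> * (\<theta>N N s x - \<theta>N M s x) + 2 * R / \<rho> * exp (- \<rho> * s)" for s
    have "g t \<le> g T"
    proof (rule DERIV_nonpos_imp_nonincreasing[OF T(2)])
      fix s assume s: "T \<le> s" "s \<le> t"
      have "(g has_real_derivative \<sigma> * (\<omega>N N s x - \<omega>N M s x) - 2 * R * exp (- \<rho> * s)) (at s)"
        unfolding g_def using N M x T s \<rho>_pos
        by (auto intro!: derivative_eq_intros \<theta>N_deriv_at simp: field_simps)
      moreover have "\<sigma> * (\<omega>N N s x - \<omega>N M s x) \<le> \<bar>\<omega>N N s x - \<omega>N M s x\<bar>"
        using \<sigma> abs_ge_self[of "\<sigma> * (\<omega>N N s x - \<omega>N M s x)"] by (simp add: abs_mult)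
      moreover have "\<bar>\<omega>N N s x - \<omega>N M s x\<bar> \<le> 2 * R * exp (- \<rho> * s)"
        using \<omega>N_decay[OF N x, of s] \<omega>N_decay[OF M x, of s] T s unfolding R_def by linarith
      ultimately show "\<exists>y. (g has_real_derivative y) (at s) \<and> y \<le> 0"
        by (intro exI conjI) (assumption, linarith)
    qed
    moreover have "0 \<le> 2 * R / \<rho> * exp (- \<rho> * t)" using R \<rho>_pos by simp
    ultimately show ?thesis unfolding g_def by linarith
  qed
  show ?thesis
    using one_sided[of 1] one_sided[of "-1"] unfolding R_def by (simp add: abs_le_iff) linarith
qed

text \<open>First \<open>T\<close> is chosen such that the drift after \<open>T\<close> is small, then the levels such that the solutions
are close up to time \<open>T\<close>.\<close>

lemma uniformly_Cauchy:
  assumes e: "0 < e"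
  shows "\<exists>N0\<ge>1. \<forall>N\<ge>N0. \<forall>M\<ge>N0. \<forall>t\<ge>0. \<forall>x\<in>D. \<bar>\<theta>N N t x - \<theta>N M t x\<bar> \<le> e"
proof -
  have "((\<lambda>T. 2 * (b - a + 1) / \<rho> * exp (- \<rho> * T)) \<longlongrightarrow> 0) at_top"
  proof -
    have "filterlim (\<lambda>T. - \<rho> * T) at_bot at_top"
      using \<rho>_pos by (intro filterlim_tendsto_neg_mult_at_bot[OF tendsto_const]) (auto intro: filterlim_ident)
    then show ?thesis
      by (intro tendsto_mult_right_zero filterlim_compose[OF exp_at_bot])
  qed
  then have "\<forall>\<^sub>F T in at_top. 2 * (b - a + 1) / \<rho> * exp (- \<rho> * T) < e / 2"
    using e by (intro order_tendstoD) auto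
  then have "\<forall>\<^sub>F T in at_top. 0 < T \<and> 2 * (b - a + 1) / \<rho> * exp (- \<rho> * T) < e / 2"
    using eventually_gt_at_top[of 0] by eventually_elim simp
  then obtain T where T: "0 < T" "2 * (b - a + 1) / \<rho> * exp (- \<rho> * T) < e / 2"
    using eventually_happens'[OF trivial_limit_at_top_linorder] by blast
  define d where "d = e / 2 / (K * exp ((C + 1) * T))"
  have d: "0 < d" using e K_ge_1 by (simp add: d_def)
  have d_eq: "K * d * exp ((C + 1) * T) = e / 2"
    using K_ge_1 by (simp add: d_def)
  have "0 < d / 2" using d by simp
  from data_approx[OF this] obtain N0 where N0: "\<And>N. N \<ge> N0 \<Longrightarrow> 1 \<le> N \<and>
      (\<forall>x\<in>D. \<bar>\<nu>N N x - \<nu> x\<bar> \<le> d / 2 \<and> \<bar>\<theta>N N 0 x - \<theta>0 x\<bar> \<le> d / 2 \<and> (\<forall>y\<in>D. \<bar>\<phi>N N x y - \<phi> x y\<bar> \<le> d / 2))"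
    unfolding eventually_sequentially by blast
  show ?thesis
  proof (intro exI[of _ N0] conjI allI impI ballI)
    show "1 \<le> N0" using N0[of N0] by simp
    fix N M t x assume NM: "N0 \<le> N" "N0 \<le> M" and t: "(0::real) \<le> t" and x: "x \<in> D"
    have N: "1 \<le> N" and M: "1 \<le> M" using N0 NM by auto
    have early: "\<bar>\<theta>N N s x - \<theta>N M s x\<bar> \<le> e / 2" if s: "0 \<le> s" "s \<le> T" for s
    proof -
      have "\<bar>\<theta>N N s x - \<theta>N M s x\<bar> \<le> K * d * exp ((C + 1) * s)"
      proof (rule finite_time_stability[OF N M less_imp_le[OF d] _ _ _ x s(1)])
        fix y z assume y: "y \<in> D" and z: "z \<in> D"
        have "\<bar>\<phi>N N y z - \<phi> y z\<bar> \<le> d / 2" "\<bar>\<phi>N M y z - \<phi> y z\<bar> \<le> d / 2"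
          using N0[OF NM(1)] N0[OF NM(2)] y z by auto
        then show "\<bar>\<phi>N N y z - \<phi>N M y z\<bar> \<le> d" by linarith
      next
        fix y assume y: "y \<in> D"
        have *: "\<bar>\<nu>N N y - \<nu> y\<bar> \<le> d / 2" "\<bar>\<nu>N M y - \<nu> y\<bar> \<le> d / 2"
          "\<bar>\<theta>N N 0 y - \<theta>0 y\<bar> \<le> d / 2" "\<bar>\<theta>N M 0 y - \<theta>0 y\<bar> \<le> d / 2"
          using N0[OF NM(1)] N0[OF NM(2)] y by auto
        show "\<bar>\<nu>N N y - \<nu>N M y\<bar> \<le> d" "\<bar>\<theta>N N 0 y - \<theta>N M 0 y\<bar> \<le> d"
          using * by linarith+
      qed
      also have "\<dots> \<le> K * d * exp ((C + 1) * T)"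
        using s C_nonneg K_ge_1 d by (intro mult_left_mono) (auto intro: mult_left_mono)
      finally show ?thesis unfolding d_eq .
    qed
    show "\<bar>\<theta>N N t x - \<theta>N M t x\<bar> \<le> e"
    proof (cases "t \<le> T")
      case True
      then show ?thesis using early[OF t] e by simp
    next
      case False
      then have "T \<le> t" by simp
      then show ?thesis
        using tail_stability[OF N M x T(1), of t] early[of T] T by linarith
    qed
  qed
qed

section \<open>The limit is a continuous solution\<close>

definition \<psi> :: "real \<Rightarrow> 'a \<Rightarrow> real" where "\<psi> t x = lim (\<lambda>N. \<theta>N N t x)"

lemma \<theta>N_tendsto: "(\<lambda>N. \<theta>N N t x) \<longlonglongrightarrow> \<psi> t x" if x: "x \<in> D" and t: "0 \<le> t"
proof -
  have "Cauchy (\<lambda>N. \<theta>N N t x)"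
  proof (rule metric_CauchyI)
    fix e :: real assume "0 < e"
    then have "0 < e / 2" by simp
    from uniformly_Cauchy[OF this] obtain N0 where
      "\<forall>N\<ge>N0. \<forall>M\<ge>N0. \<forall>t\<ge>0. \<forall>x\<in>D. \<bar>\<theta>N N t x - \<theta>N M t x\<bar> \<le> e / 2" by blast
    then have "\<forall>N\<ge>N0. \<forall>M\<ge>N0. dist (\<theta>N N t x) (\<theta>N M t x) < e"
      using x t \<open>0 < e\<close> by (fastforce simp: dist_real_def)
    then show "\<exists>N0. \<forall>N\<ge>N0. \<forall>M\<ge>N0. dist (\<theta>N N t x) (\<theta>N M t x) < e" by blast
  qed
  then show ?thesis
    unfolding \<psi>_def by (simp add: Cauchy_convergent_iff convergent_LIMSEQ_iff)
qed

lemma uniform_convergence: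
  assumes e: "0 < e"
  shows "\<forall>\<^sub>F N in sequentially. \<forall>t\<ge>0. \<forall>x\<in>D. \<bar>\<theta>N N t x - \<psi> t x\<bar> \<le> e"
proof -
  obtain N0 where N0: "\<And>N M t x. N0 \<le> N \<Longrightarrow> N0 \<le> M \<Longrightarrow> 0 \<le> t \<Longrightarrow> x \<in> D \<Longrightarrow> \<bar>\<theta>N N t x - \<theta>N M t x\<bar> \<le> e"
    using uniformly_Cauchy[OF e] by blast
  show ?thesis
    unfolding eventually_sequentially
  proof (intro exI[of _ N0] allI impI ballI)
    fix N t x assume N: "N0 \<le> N" and t: "(0::real) \<le> t" and x: "x \<in> D"
    have "(\<lambda>M. \<bar>\<theta>N N t x - \<theta>N M t x\<bar>) \<longlonglongrightarrow> \<bar>\<theta>N N t x - \<psi> t x\<bar>"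
      by (intro tendsto_intros \<theta>N_tendsto x t)
    then show "\<bar>\<theta>N N t x - \<psi> t x\<bar> \<le> e"
      by (rule LIMSEQ_le_const2) (use N0[OF N _ t x] in blast)
  qed
qed

lemma \<psi>_measurable: "0 \<le> t \<Longrightarrow> \<psi> t \<in> borel_measurable (lebesgue_on D)"
  by (rule borel_measurable_LIMSEQ_real[of _ "\<lambda>N. \<theta>N N t"]) (use \<theta>N_tendsto in auto)

lemma \<psi>_init: "\<psi> 0 x = \<theta>0 x" if x: "x \<in> D"
proof -
  have "(\<lambda>N. \<theta>N N 0 x) \<longlonglongrightarrow> \<theta>0 x"
  proof (rule metric_LIMSEQ_I)
    fix r :: real assume "0 < r"
    then have "0 < r / 2" by simp
    from data_approx[OF this] have "\<forall>\<^sub>F N in sequentially. dist (\<theta>N N 0 x) (\<theta>0 x) < r"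
      by eventually_elim (use x \<open>0 < r\<close> in \<open>force simp: dist_real_def\<close>)
    then show "\<exists>no. \<forall>n\<ge>no. dist (\<theta>N n 0 x) (\<theta>0 x) < r" by (simp add: eventually_sequentially)
  qed
  then show ?thesis using LIMSEQ_unique[OF \<theta>N_tendsto[OF x]] by blast
qed

definition coupling :: "real \<Rightarrow> 'a \<Rightarrow> real" where
  "coupling t x = avg (\<lambda>z. \<phi> x z * sin (\<psi> t z - \<psi> t x))"

text \<open>The frequency prescribed by the continuum equation, that is \<open>F\<^sup>-\<^sup>1\<close> of its right-hand side; that it is
the derivative of \<open>\<psi>\<close> is shown in \<open>\<psi>_deriv\<close>.\<close>

definition \<omega> :: "real \<Rightarrow> 'a \<Rightarrow> real" where
  "\<omega> t x = (SOME v. v \<in> {a..b} \<and> F v = \<nu> x + \<kappa> * coupling t x)"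

lemma force_in_range:
  assumes x: "x \<in> D" and f: "\<bar>f\<bar> \<le> b\<^sub>\<Phi>"
  shows "F a \<le> \<nu> x + \<kappa> * f" "\<nu> x + \<kappa> * f \<le> F b"
proof -
  have "\<bar>\<kappa> * f\<bar> \<le> \<kappa> * b\<^sub>\<Phi>" using f \<kappa>_pos by (simp add: abs_mult)
  then show "F a \<le> \<nu> x + \<kappa> * f" "\<nu> x + \<kappa> * f \<le> F b"
    using \<nu>_bounds[OF x] by (simp_all add: abs_le_iff)
qed

lemma \<omega>: "\<omega> t x \<in> {a..b}" "F (\<omega> t x) = \<nu> x + \<kappa> * coupling t x" if x: "x \<in> D" and t: "0 \<le> t"
proof -
  have "\<bar>coupling t x\<bar> \<le> b\<^sub>\<Phi>"
    unfolding coupling_def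
    by (rule avg_coupling_abs_le) (use \<phi>_measurable \<psi>_measurable \<phi>_abs_le x t in auto)
  then have "\<exists>v. v \<in> {a..b} \<and> F v = \<nu> x + \<kappa> * coupling t x"
    using F_onto force_in_range[OF x] by blast
  from someI_ex[OF this] show "\<omega> t x \<in> {a..b}" "F (\<omega> t x) = \<nu> x + \<kappa> * coupling t x"
    by (simp_all add: \<omega>_def)
qed

lemma \<omega>N_tendsto: "(\<lambda>N. \<omega>N N t x) \<longlonglongrightarrow> \<omega> t x" if x: "x \<in> D" and t: "0 \<le> t"
proof (rule metric_LIMSEQ_I)
  fix r :: real assume r: "0 < r"
  define e where "e = r / 2 / (K + C)"
  have KC: "0 < K + C" using K_ge_1 C_nonneg by simp
  have e: "0 < e" using r KC by (simp add: e_def)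
  have "\<forall>\<^sub>F N in sequentially. dist (\<omega>N N t x) (\<omega> t x) < r"
    using data_approx[OF e] uniform_convergence[OF e]
  proof eventually_elim
    case (elim N)
    then have N: "1 \<le> N" by simp
    have "\<bar>\<omega>N N t x - \<omega> t x\<bar> \<le> K * e + C * e"
    proof (rule frequency_diff_le[OF \<omega>N_range[OF N x t] \<omega>N_eq[OF N x t] \<omega>[OF x t]])
      show "\<bar>avg (\<lambda>z. \<phi>N N x z * sin (\<theta>N N t z - \<theta>N N t x)) - coupling t x\<bar>
          \<le> e + b\<^sub>\<Phi> * (e + \<bar>\<theta>N N t x - \<psi> t x\<bar>)"
        unfolding coupling_def
        by (rule avg_coupling_diff_le)
           (use elim N x t \<phi>N_bounds \<phi>_abs_le \<phi>_measurable \<psi>_measurable in \<open>auto intro!: AE_I2\<close>)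
      show "e + \<bar>\<theta>N N t x - \<psi> t x\<bar> \<le> 2 * e" using elim x t by auto
    qed (use elim x e in auto)
    also have "\<dots> = (K + C) * e" by (simp add: distrib_right)
    also have "\<dots> = r / 2"
      unfolding e_def using KC by (intro trans[OF times_divide_eq_right nonzero_mult_div_cancel_left]) simp
    finally show ?case using r by (simp add: dist_real_def)
  qed
  then show "\<exists>no. \<forall>n\<ge>no. dist (\<omega>N n t x) (\<omega> t x) < r" by (simp add: eventually_sequentially)
qed

lemma \<omega>_measurable: "0 \<le> t \<Longrightarrow> \<omega> t \<in> borel_measurable (lebesgue_on D)"
proof (rule borel_measurable_LIMSEQ_real[of _ "\<lambda>N. \<omega>N N t"])
  show "\<omega>N N t \<in> borel_measurable (lebesgue_on D)" for N
    unfolding \<omega>N_def by (rule step_measurable)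
qed (use \<omega>N_tendsto in auto)

text \<open>Lipschitz constants in time of the phases and of the frequencies, valid at all levels.\<close>

definition V :: real where "V = max \<bar>a\<bar> \<bar>b\<bar>"
definition W :: real where "W = C * V"

lemma V_nonneg: "0 \<le> V" and W_nonneg: "0 \<le> W"
  using C_nonneg by (auto simp: V_def W_def)

lemma \<theta>N_mean_value:
  assumes N: "1 \<le> N" and x: "x \<in> D" and s: "0 \<le> s" and t: "0 \<le> t"
  obtains r where "0 \<le> r" "\<bar>r - t\<bar> \<le> \<bar>s - t\<bar>" "\<theta>N N s x - \<theta>N N t x = (s - t) * \<omega>N N r x"
proof -
  have *: "\<exists>r. v < r \<and> r < w \<and> \<theta>N N w x - \<theta>N N v x = \<omega>N N r x * (w - v)" if "0 \<le> v" "v < w" for v w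
  proof -
    have "((\<lambda>s. \<theta>N N s x) has_derivative (*) (\<omega>N N r x)) (at r within {v..w})" if "v \<le> r" "r \<le> w" for r
    proof -
      have "((\<lambda>s. \<theta>N N s x) has_real_derivative \<omega>N N r x) (at r within {v..w})"
        using DERIV_subset[OF \<theta>N_deriv[OF N x, of r], of "{v..w}"] that \<open>0 \<le> v\<close> by auto
      then show ?thesis by (simp add: has_field_derivative_def)
    qed
    from mvt_simple[OF \<open>v < w\<close> this] show ?thesis by auto
  qed
  consider "s = t" | "s < t" | "t < s" by linarith
  then show thesis
  proof cases
    case 1
    then show ?thesis using that[of t] t by simp
  next
    case 2
    with *[OF s] obtain r where "s < r" "r < t" "\<theta>N N t x - \<theta>N N s x = \<omega>N N r x * (t - s)" by blast
    then show ?thesis using that[of r] s by (simp add: algebra_simps)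
  next
    case 3
    with *[OF t] obtain r where "t < r" "r < s" "\<theta>N N s x - \<theta>N N t x = \<omega>N N r x * (s - t)" by blast
    then show ?thesis using that[of r] t by (simp add: algebra_simps)
  qed
qed

lemma \<theta>N_lipschitz: "\<bar>\<theta>N N s x - \<theta>N N t x\<bar> \<le> V * \<bar>s - t\<bar>"
  if N: "1 \<le> N" and x: "x \<in> D" and st: "0 \<le> s" "0 \<le> t"
proof -
  obtain r where r: "0 \<le> r" "\<theta>N N s x - \<theta>N N t x = (s - t) * \<omega>N N r x"
    using \<theta>N_mean_value[OF N x st] by metis
  have "\<bar>\<omega>N N r x\<bar> \<le> V" using \<omega>N_range[OF N x r(1)] by (auto simp: V_def)
  then show ?thesis
    using mult_left_mono[of "\<bar>\<omega>N N r x\<bar>" V "\<bar>s - t\<bar>"] r(2) by (simp add: abs_mult mult.commute)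
qed

lemma \<omega>N_lipschitz: "\<bar>\<omega>N N s x - \<omega>N N t x\<bar> \<le> W * \<bar>s - t\<bar>"
  if N: "1 \<le> N" and x: "x \<in> D" and st: "0 \<le> s" "0 \<le> t"
proof -
  have "\<bar>\<omega>N N s x - \<omega>N N t x\<bar> \<le> K * 0 + C * (V * \<bar>s - t\<bar>)"
  proof (rule frequency_diff_le[OF \<omega>N_range[OF N x st(1)] \<omega>N_eq[OF N x st(1)]
        \<omega>N_range[OF N x st(2)] \<omega>N_eq[OF N x st(2)] _ avg_coupling_diff_le])
    show "V * \<bar>s - t\<bar> + \<bar>\<theta>N N s x - \<theta>N N t x\<bar> \<le> 2 * (V * \<bar>s - t\<bar>)"
      using \<theta>N_lipschitz[OF N x st] by simp
  qed (use \<phi>N_bounds \<theta>N_lipschitz N x st in \<open>auto intro!: AE_I2\<close>)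
  then show ?thesis by (simp add: W_def mult_ac)
qed

lemma \<theta>N_first_order: "\<bar>\<theta>N N s x - \<theta>N N t x - (s - t) * \<omega>N N t x\<bar> \<le> W * \<bar>s - t\<bar>\<^sup>2"
  if N: "1 \<le> N" and x: "x \<in> D" and st: "0 \<le> s" "0 \<le> t"
proof -
  obtain r where r: "0 \<le> r" "\<bar>r - t\<bar> \<le> \<bar>s - t\<bar>" "\<theta>N N s x - \<theta>N N t x = (s - t) * \<omega>N N r x"
    using \<theta>N_mean_value[OF N x st] by metis
  have "\<bar>\<theta>N N s x - \<theta>N N t x - (s - t) * \<omega>N N t x\<bar> = \<bar>s - t\<bar> * \<bar>\<omega>N N r x - \<omega>N N t x\<bar>"
    unfolding r(3) by (simp add: abs_mult flip: right_diff_distrib)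
  also have "\<dots> \<le> \<bar>s - t\<bar> * (W * \<bar>s - t\<bar>)"
    using \<omega>N_lipschitz[OF N x r(1) st(2)] mult_left_mono[OF r(2) W_nonneg]
    by (intro mult_left_mono) auto
  finally show ?thesis by (simp add: power2_eq_square mult_ac)
qed

lemma \<psi>_lipschitz: "\<bar>\<psi> s x - \<psi> t x\<bar> \<le> V * \<bar>s - t\<bar>" if x: "x \<in> D" and st: "0 \<le> s" "0 \<le> t"
proof (rule LIMSEQ_le_const2)
  show "(\<lambda>N. \<bar>\<theta>N N s x - \<theta>N N t x\<bar>) \<longlonglongrightarrow> \<bar>\<psi> s x - \<psi> t x\<bar>"
    by (intro tendsto_intros \<theta>N_tendsto that)
qed (use \<theta>N_lipschitz that in blast)

lemma \<omega>_lipschitz: "\<bar>\<omega> s x - \<omega> t x\<bar> \<le> W * \<bar>s - t\<bar>" if x: "x \<in> D" and st: "0 \<le> s" "0 \<le> t"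
proof (rule LIMSEQ_le_const2)
  show "(\<lambda>N. \<bar>\<omega>N N s x - \<omega>N N t x\<bar>) \<longlonglongrightarrow> \<bar>\<omega> s x - \<omega> t x\<bar>"
    by (intro tendsto_intros \<omega>N_tendsto that)
qed (use \<omega>N_lipschitz that in blast)

text \<open>Passing to the limit in \<open>\<theta>N_first_order\<close> avoids interchanging limits and derivatives, and the bound
is uniform in \<open>x\<close> as required for derivatives in \<open>L\<^sup>\<infinity>\<close>.\<close>

lemma \<psi>_difference_quotient: "\<bar>(\<psi> s x - \<psi> t x) / (s - t) - \<omega> t x\<bar> \<le> W * \<bar>s - t\<bar>"
  if x: "x \<in> D" and st: "0 \<le> s" "0 \<le> t" and "s \<noteq> t"
proof -
  have "\<bar>\<psi> s x - \<psi> t x - (s - t) * \<omega> t x\<bar> \<le> W * \<bar>s - t\<bar>\<^sup>2"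
  proof (rule LIMSEQ_le_const2)
    show "(\<lambda>N. \<bar>\<theta>N N s x - \<theta>N N t x - (s - t) * \<omega>N N t x\<bar>) \<longlonglongrightarrow>
        \<bar>\<psi> s x - \<psi> t x - (s - t) * \<omega> t x\<bar>"
      by (intro tendsto_intros \<theta>N_tendsto \<omega>N_tendsto x st)
  qed (use \<theta>N_first_order x st in blast)
  moreover have "(\<psi> s x - \<psi> t x) / (s - t) - \<omega> t x = (\<psi> s x - \<psi> t x - (s - t) * \<omega> t x) / (s - t)"
    using \<open>s \<noteq> t\<close> by (simp add: diff_divide_distrib)
  moreover have "0 < \<bar>s - t\<bar>" using \<open>s \<noteq> t\<close> by simp
  ultimately show ?thesis
    by (simp only: abs_divide pos_divide_le_eq power2_eq_square mult.assoc)
qed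

lemma \<psi>_deriv: "((\<lambda>s. \<psi> s x) has_real_derivative \<omega> t x) (at t within {0..})" if x: "x \<in> D" and t: "0 \<le> t"
  unfolding has_field_derivative_iff
proof (rule LIM_zero_cancel, rule Lim_null_comparison)
  show "((\<lambda>s. W * \<bar>s - t\<bar>) \<longlongrightarrow> 0) (at t within {0..})"
    by (auto intro!: tendsto_eq_intros)
  show "\<forall>\<^sub>F s in at t within {0..}. norm ((\<psi> s x - \<psi> t x) / (s - t) - \<omega> t x) \<le> W * \<bar>s - t\<bar>"
    using \<psi>_difference_quotient[OF x _ t] by (simp add: eventually_at_filter)
qed

text \<open>Gronwall's inequality for the single function \<open>\<psi>(t, x) - \<psi>(t, y)\<close>: the two points see the same phases
\<open>\<psi>(t, z)\<close>, so only the data at \<open>x\<close> and \<open>y\<close> differ.\<close>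

lemma spatial_modulus:
  assumes x: "x \<in> D" and y: "y \<in> D" and e: "0 \<le> e"
    and data: "\<bar>\<nu> x - \<nu> y\<bar> \<le> e" "\<bar>\<theta>0 x - \<theta>0 y\<bar> \<le> e" "\<And>z. z \<in> D \<Longrightarrow> \<bar>\<phi> x z - \<phi> y z\<bar> \<le> e"
    and t: "0 \<le> t"
  shows "\<bar>\<psi> t x - \<psi> t y\<bar> \<le> K * e * exp ((C + 1) * t)"
proof (rule gronwall_finite_family[of "\<lambda>_ s. \<psi> s x - \<psi> s y" "{()}" "\<lambda>_ s. \<omega> s x - \<omega> s y",
      OF _ _ _ _ _ C_nonneg _ t])
  fix s r assume s: "0 < s" and "\<And>u. u \<in> {()} \<Longrightarrow> \<bar>\<psi> s x - \<psi> s y\<bar> \<le> r"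
  then have r: "\<bar>\<psi> s x - \<psi> s y\<bar> \<le> r" by simp
  have s0: "0 \<le> s" using s by simp
  show "\<bar>\<omega> s x - \<omega> s y\<bar> \<le> K * e + C * r"
  proof (rule frequency_diff_le[OF \<omega>[OF x s0] \<omega>[OF y s0] data(1)])
    show "\<bar>coupling s x - coupling s y\<bar> \<le> e + b\<^sub>\<Phi> * (0 + \<bar>\<psi> s x - \<psi> s y\<bar>)"
      unfolding coupling_def
      by (rule avg_coupling_diff_le)
         (use x y s0 data(3) \<phi>_measurable \<psi>_measurable \<phi>_abs_le in auto)
    show "0 + \<bar>\<psi> s x - \<psi> s y\<bar> \<le> 2 * r" using r by simp
  qed (rule e)
next
  show "\<bar>\<psi> 0 x - \<psi> 0 y\<bar> \<le> K * e"
    using data(2) mult_right_mono[OF K_ge_1 e] x y by (simp add: \<psi>_init)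
next
  fix s :: real assume "0 < s"
  then show "((\<lambda>s. \<psi> s x - \<psi> s y) has_real_derivative \<omega> s x - \<omega> s y) (at s)"
    using \<psi>_deriv[OF x, of s] \<psi>_deriv[OF y, of s] by (auto intro!: derivative_eq_intros simp: at_within_nonneg)
next
  have "continuous_on {0..} (\<lambda>s. \<psi> s z)" if "z \<in> D" for z
    by (rule DERIV_continuous_on[of _ _ "\<lambda>t. \<omega> t z"]) (use \<psi>_deriv that in auto)
  then show "continuous_on {0..} (\<lambda>s. \<psi> s x - \<psi> s y)"
    using x y by (intro continuous_intros)
qed auto

lemma \<psi>_continuous: "continuous_on ({0..} \<times> D) (\<lambda>(t, x). \<psi> t x)"
  unfolding continuous_on_iff
proof (intro ballI allI impI)
  fix p :: "real \<times> 'a" and r :: real assume "p \<in> {0..} \<times> D" and r: "0 < r"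
  then obtain t x where p: "p = (t, x)" and t: "0 \<le> t" and x: "x \<in> D" by auto
  define e where "e = r / 2 / (K * exp ((C + 1) * t))"
  have e: "0 < e" using r K_ge_1 by (simp add: e_def)
  have e_eq: "K * e * exp ((C + 1) * t) = r / 2" using K_ge_1 by (simp add: e_def)
  obtain d1 where d1: "0 < d1" "\<And>y. y \<in> D \<Longrightarrow> dist y x < d1 \<Longrightarrow> dist (\<nu> y) (\<nu> x) < e"
    using \<nu>_cont x e unfolding continuous_on_iff by metis
  obtain d2 where d2: "0 < d2" "\<And>y. y \<in> D \<Longrightarrow> dist y x < d2 \<Longrightarrow> dist (\<theta>0 y) (\<theta>0 x) < e"
    using \<theta>0_cont x e unfolding continuous_on_iff by metis
  have "uniformly_continuous_on (D \<times> D) (\<lambda>(x, y). \<phi> x y)"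
    using \<phi>_cont D_compact by (intro compact_uniformly_continuous compact_Times)
  then obtain d3 where d3: "0 < d3" "\<And>p q. p \<in> D \<times> D \<Longrightarrow> q \<in> D \<times> D \<Longrightarrow> dist q p < d3 \<Longrightarrow>
      dist (case q of (x, y) \<Rightarrow> \<phi> x y) (case p of (x, y) \<Rightarrow> \<phi> x y) < e"
    using e unfolding uniformly_continuous_on_def by metis
  define d4 where "d4 = r / 2 / (V + 1)"
  have d4: "0 < d4" "V * d4 < r / 2"
    using r V_nonneg by (simp_all add: d4_def field_simps)
  show "\<exists>d>0. \<forall>q\<in>{0..} \<times> D. dist q p < d \<longrightarrow>
      dist (case q of (t, x) \<Rightarrow> \<psi> t x) (case p of (t, x) \<Rightarrow> \<psi> t x) < r"
  proof (intro exI[of _ "min (min d1 d2) (min d3 d4)"] conjI ballI impI)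
    fix q assume "q \<in> {0..} \<times> D" and near: "dist q p < min (min d1 d2) (min d3 d4)"
    then obtain s y where q: "q = (s, y)" and s: "0 \<le> s" and y: "y \<in> D" by auto
    have "dist y x \<le> dist q p" "dist s t \<le> dist q p"
      unfolding p q by (metis dist_fst_le dist_snd_le fst_conv snd_conv)+
    then have close: "dist y x < d1" "dist y x < d2" "dist y x < d3" "\<bar>s - t\<bar> < d4"
      using near by (auto simp: dist_real_def)
    have "\<bar>\<psi> s y - \<psi> t y\<bar> \<le> V * \<bar>s - t\<bar>" by (rule \<psi>_lipschitz[OF y s t])
    also have "\<dots> \<le> V * d4" using close V_nonneg by (intro mult_left_mono) auto
    finally have "\<bar>\<psi> s y - \<psi> t y\<bar> < r / 2" using d4 by simp
    moreover have "\<bar>\<psi> t y - \<psi> t x\<bar> \<le> K * e * exp ((C + 1) * t)"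
    proof (rule spatial_modulus[OF y x less_imp_le[OF e] _ _ _ t])
      show "\<bar>\<nu> y - \<nu> x\<bar> \<le> e" "\<bar>\<theta>0 y - \<theta>0 x\<bar> \<le> e"
        using d1(2)[OF y] d2(2)[OF y] close by (auto simp: dist_real_def)
      show "\<bar>\<phi> y z - \<phi> x z\<bar> \<le> e" if "z \<in> D" for z
        using d3(2)[of "(x, z)" "(y, z)"] close x y that by (simp add: dist_Pair_Pair dist_real_def)
    qed
    ultimately show "dist (case q of (t, x) \<Rightarrow> \<psi> t x) (case p of (t, x) \<Rightarrow> \<psi> t x) < r"
      unfolding p q e_eq prod.case dist_real_def by linarith
  qed (use d1 d2 d3 d4 in auto)
qed

end

section \<open>Convergence and uniqueness in the essential supremum norm\<close>

lemma Linfty_norm_leI: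
  assumes "f \<in> borel_measurable M" "AE x in M. \<bar>f x\<bar> \<le> c"
  shows "Linfty_norm M f \<le> ereal c"
  unfolding Linfty_norm_def using assms by (intro esssup_I) auto

lemma Linfty_norm_AE: "AE x in M. ereal \<bar>f x\<bar> \<le> Linfty_norm M f"
  unfolding Linfty_norm_def by (rule esssup_AE)

lemma Linfty_norm_nonneg:
  assumes "emeasure M (space M) \<noteq> 0"
  shows "0 \<le> Linfty_norm M f"
  using esssup_const[OF assms, of "0::ereal"] esssup_mono[of "\<lambda>_. 0::ereal" M "\<lambda>x. ereal \<bar>f x\<bar>"]
  by (simp add: Linfty_norm_def)

lemma Linfty_normE:
  assumes "emeasure M (space M) \<noteq> 0" "Linfty_norm M f < \<infinity>"
  obtains c where "0 \<le> c" "Linfty_norm M f = ereal c" "AE x in M. \<bar>f x\<bar> \<le> c"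
proof -
  obtain c where c: "Linfty_norm M f = ereal c" "0 \<le> c"
    using Linfty_norm_nonneg[OF assms(1), of f] assms(2) by (cases "Linfty_norm M f") auto
  then have "AE x in M. \<bar>f x\<bar> \<le> c" using Linfty_norm_AE[of f M] by simp
  with c that show ?thesis by blast
qed

text \<open>Norms are extended reals in this section, so convergence to zero is tested with real bounds.\<close>

lemma tendsto_zero_ereal:
  fixes f :: "'b \<Rightarrow> ereal"
  assumes nonneg: "\<And>x. 0 \<le> f x" and small: "\<And>e. 0 < e \<Longrightarrow> \<forall>\<^sub>F x in G. f x \<le> ereal e"
  shows "(f \<longlongrightarrow> 0) G"
proof (rule order_tendstoI)
  fix y :: ereal assume "y < 0"
  then show "\<forall>\<^sub>F x in G. y < f x"
    using nonneg by (intro always_eventually) (auto intro: less_le_trans)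
next
  fix y :: ereal assume "0 < y"
  then obtain e where "0 < ereal e" "ereal e < y" using ereal_dense2 by blast
  then have "0 < e" "ereal e < y" by auto
  from small[OF this(1)] this(2) show "\<forall>\<^sub>F x in G. f x < y"
    by (auto elim: eventually_mono)
qed

context kuramoto_continuum
begin

lemmas Linfty_D_nonneg = Linfty_norm_nonneg[OF emeasure_lebesgue_on_D]

lemma Linfty_D_leI:
  assumes "f \<in> borel_measurable (lebesgue_on D)" "\<And>x. x \<in> D \<Longrightarrow> \<bar>f x\<bar> \<le> r"
  shows "Linfty_norm (lebesgue_on D) f \<le> ereal r"
  using assms by (intro Linfty_norm_leI) (auto intro!: AE_I2)

lemma \<psi>_Linfty: "\<psi> t \<in> Linfty (lebesgue_on D)" if t: "0 \<le> t"
proof -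
  have "continuous_on D (\<lambda>x. (t, x))" by (intro continuous_intros)
  from continuous_on_compose2[OF \<psi>_continuous this] have "continuous_on D (\<psi> t)"
    using t by (simp add: image_subset_iff)
  then obtain r where "\<And>x. x \<in> D \<Longrightarrow> \<bar>\<psi> t x\<bar> \<le> r"
    using compact_imp_bounded[OF compact_continuous_image[OF _ D_compact]] by (force simp: bounded_iff)
  from Linfty_D_leI[OF \<psi>_measurable[OF t] this] show ?thesis
    using \<psi>_measurable[OF t] by (auto simp: Linfty_def)
qed

lemma \<omega>_Linfty: "\<omega> t \<in> Linfty (lebesgue_on D)" if t: "0 \<le> t"
proof -
  have "\<bar>\<omega> t x\<bar> \<le> V" if "x \<in> D" for x using \<omega>(1)[OF that t] by (auto simp: V_def)
  from Linfty_D_leI[OF \<omega>_measurable[OF t] this] show ?thesis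
    using \<omega>_measurable[OF t] by (auto simp: Linfty_def)
qed

lemma eventually_W_small:
  assumes "0 < e"
  shows "\<forall>\<^sub>F s in at t within {0..}. 0 \<le> s \<and> s \<noteq> t \<and> W * \<bar>s - t\<bar> \<le> e"
proof -
  have "((\<lambda>s. W * \<bar>s - t\<bar>) \<longlongrightarrow> 0) (at t within {0..})"
    by (auto intro!: tendsto_eq_intros)
  from order_tendstoD(2)[OF this assms] have "\<forall>\<^sub>F s in at t within {0..}. W * \<bar>s - t\<bar> < e" .
  moreover have "\<forall>\<^sub>F s in at t within {0..}. 0 \<le> s \<and> s \<noteq> t"
    by (simp add: eventually_at_filter)
  ultimately show ?thesis by eventually_elim simp
qed

lemma \<psi>_C1: "C1_Linfty_with (lebesgue_on D) \<psi> \<omega>"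
  unfolding C1_Linfty_with_def
proof (intro conjI allI impI)
  fix t :: real assume t: "0 \<le> t"
  show "\<psi> t \<in> Linfty (lebesgue_on D)" "\<omega> t \<in> Linfty (lebesgue_on D)"
    using t by (rule \<psi>_Linfty, rule \<omega>_Linfty)
  show "((\<lambda>s. Linfty_norm (lebesgue_on D) (\<lambda>x. (\<psi> s x - \<psi> t x) / (s - t) - \<omega> t x)) \<longlongrightarrow> 0)
      (at t within {0..})"
  proof (rule tendsto_zero_ereal[OF Linfty_D_nonneg])
    fix e :: real assume "0 < e"
    from eventually_W_small[OF this]
    show "\<forall>\<^sub>F s in at t within {0..}.
        Linfty_norm (lebesgue_on D) (\<lambda>x. (\<psi> s x - \<psi> t x) / (s - t) - \<omega> t x) \<le> ereal e"
    proof eventually_elim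
      case (elim s)
      note [measurable] = \<psi>_measurable[OF t] \<psi>_measurable[of s] \<omega>_measurable[OF t]
      show ?case
        using elim \<psi>_difference_quotient[OF _ _ t, of _ s] by (intro Linfty_D_leI) (auto intro: order_trans)
    qed
  qed
  show "((\<lambda>s. Linfty_norm (lebesgue_on D) (\<lambda>x. \<omega> s x - \<omega> t x)) \<longlongrightarrow> 0) (at t within {0..})"
  proof (rule tendsto_zero_ereal[OF Linfty_D_nonneg])
    fix e :: real assume "0 < e"
    from eventually_W_small[OF this]
    show "\<forall>\<^sub>F s in at t within {0..}. Linfty_norm (lebesgue_on D) (\<lambda>x. \<omega> s x - \<omega> t x) \<le> ereal e"
    proof eventually_elim
      case (elim s)
      note [measurable] = \<omega>_measurable[OF t] \<omega>_measurable[of s]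
      show ?case
        using elim \<omega>_lipschitz[OF _ _ t, of _ s] by (intro Linfty_D_leI) (auto intro: order_trans)
    qed
  qed
qed

lemma \<psi>_limit: "uniform_limit_of_lattice D P \<Theta> \<psi>"
  unfolding uniform_limit_of_lattice_def
proof (rule tendsto_zero_ereal)
  fix N
  have "0 \<le> Linfty_norm (lebesgue_on D) (\<lambda>x. step_function P \<Theta> N 0 x - \<psi> 0 x)"
    by (rule Linfty_D_nonneg)
  also have "\<dots> \<le> (SUP t\<in>{0..}. Linfty_norm (lebesgue_on D) (\<lambda>x. step_function P \<Theta> N t x - \<psi> t x))"
    by (rule SUP_upper) simp
  finally show "0 \<le> (SUP t\<in>{0..}. Linfty_norm (lebesgue_on D) (\<lambda>x. step_function P \<Theta> N t x - \<psi> t x))" .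
next
  fix e :: real assume "0 < e"
  from uniform_convergence[OF this] show "\<forall>\<^sub>F N in sequentially.
      (SUP t\<in>{0..}. Linfty_norm (lebesgue_on D) (\<lambda>x. step_function P \<Theta> N t x - \<psi> t x)) \<le> ereal e"
  proof eventually_elim
    case (elim N)
    show ?case
    proof (rule SUP_least)
      fix t :: real assume "t \<in> {0..}"
      then have t: "0 \<le> t" by simp
      have step: "step_function P \<Theta> N t x = \<theta>N N t x" if "x \<in> D" for x
        unfolding step_function_def \<theta>N_def by (rule indicator_sum_eq_cell[OF that])
      have "(\<lambda>x. step_function P \<Theta> N t x - \<psi> t x) \<in> borel_measurable (lebesgue_on D)"
        using measurable_lebesgue_cong[of D "\<lambda>x. step_function P \<Theta> N t x - \<psi> t x" "\<lambda>x. \<theta>N N t x - \<psi> t x" borel]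
          step \<psi>_measurable[OF t] by simp
      then show "Linfty_norm (lebesgue_on D) (\<lambda>x. step_function P \<Theta> N t x - \<psi> t x) \<le> ereal e"
        by (rule Linfty_D_leI) (use elim t step in simp)
    qed
  qed
qed

lemma equation_iff_avg:
  "\<nu> x + \<kappa> / \<mu> * (LINT z:D|lebesgue. \<phi> x z * sin (u z - u x)) = \<nu> x + \<kappa> * avg (\<lambda>z. \<phi> x z * sin (u z - u x))"
  by (simp add: avg_def)

lemma \<psi>_solution: "classical_solution L F \<kappa> D \<nu> \<phi> \<theta>0 \<psi>" if S: "S = sym_interval L"
  unfolding classical_solution_def
proof (intro exI[of _ \<omega>] conjI allI impI \<psi>_C1)
  fix t :: real assume t: "0 \<le> t"
  show "AE x in lebesgue_on D. \<omega> t x \<in> sym_interval L \<and>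
      F (\<omega> t x) = \<nu> x + \<kappa> / \<mu> * (LINT z:D|lebesgue. \<phi> x z * sin (\<psi> t z - \<psi> t x))"
    unfolding equation_iff_avg
    using \<omega>[OF _ t] ab_subset S by (auto intro!: AE_I2 simp: coupling_def)
qed (auto intro!: AE_I2 simp: \<psi>_init)

text \<open>The equation determines the frequency of a classical solution as a Lipschitz function of its
phases, so the norm \<open>w\<close> of the difference of two solutions has difference quotients bounded by
\<open>C w\<close> up to a small error, and \<open>dini_gronwall_zero\<close> applies. The exceptional null sets depend on time;
therefore the argument uses norms at fixed times and never follows a single point \<open>x\<close>.\<close>

lemma classical_solution_unique:
  assumes S: "S = sym_interval L" and "classical_solution L F \<kappa> D \<nu> \<phi> \<theta>0 \<eta>"
  shows "Linfty_curve_eq (lebesgue_on D) \<eta> \<psi>"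
proof -
  let ?M = "lebesgue_on D"
  obtain \<eta>' where C1: "C1_Linfty_with ?M \<eta> \<eta>'"
    and eq: "\<And>t. 0 \<le> t \<Longrightarrow> AE x in ?M. \<eta>' t x \<in> S \<and>
      F (\<eta>' t x) = \<nu> x + \<kappa> * avg (\<lambda>z. \<phi> x z * sin (\<eta> t z - \<eta> t x))"
    and init: "AE x in ?M. \<eta> 0 x = \<theta>0 x"
    using assms(2) unfolding classical_solution_def equation_iff_avg S by blast
  have \<eta>_Linfty: "\<eta> t \<in> Linfty ?M" "\<eta>' t \<in> Linfty ?M" if "0 \<le> t" for t
    using C1 that by (auto simp: C1_Linfty_with_def)
  have \<eta>_measurable: "\<eta> t \<in> borel_measurable ?M" "\<eta>' t \<in> borel_measurable ?M" if "0 \<le> t" for t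
    using \<eta>_Linfty[OF that] by (auto simp: Linfty_def)
  define w where "w t = real_of_ereal (Linfty_norm ?M (\<lambda>x. \<eta> t x - \<psi> t x))" for t
  have diff_measurable: "(\<lambda>x. \<eta> t x - \<psi> t x) \<in> borel_measurable ?M" if "0 \<le> t" for t
    using \<eta>_measurable[OF that] \<psi>_measurable[OF that] by simp
  have w: "0 \<le> w t" "AE x in ?M. \<bar>\<eta> t x - \<psi> t x\<bar> \<le> w t" if t: "0 \<le> t" for t
  proof -
    obtain r1 where r1: "AE x in ?M. \<bar>\<eta> t x\<bar> \<le> r1"
      using \<eta>_Linfty(1)[OF t] Linfty_normE[OF emeasure_lebesgue_on_D, of "\<eta> t"] unfolding Linfty_def by blast
    obtain r2 where r2: "AE x in ?M. \<bar>\<psi> t x\<bar> \<le> r2"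
      using \<psi>_Linfty[OF t] Linfty_normE[OF emeasure_lebesgue_on_D, of "\<psi> t"] unfolding Linfty_def by blast
    have "AE x in ?M. \<bar>\<eta> t x - \<psi> t x\<bar> \<le> r1 + r2"
      using r1 r2 by eventually_elim linarith
    from Linfty_norm_leI[OF diff_measurable[OF t] this]
    have "Linfty_norm ?M (\<lambda>x. \<eta> t x - \<psi> t x) < \<infinity>"
      by (rule le_less_trans) simp
    from Linfty_normE[OF emeasure_lebesgue_on_D this]
    show "0 \<le> w t" "AE x in ?M. \<bar>\<eta> t x - \<psi> t x\<bar> \<le> w t"
      unfolding w_def by (metis real_of_ereal.simps(1))+
  qed
  have w_le: "w t \<le> r" if t: "0 \<le> t" and r: "AE x in ?M. \<bar>\<eta> t x - \<psi> t x\<bar> \<le> r" for t r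
  proof -
    have "Linfty_norm ?M (\<lambda>x. \<eta> t x - \<psi> t x) \<le> ereal r"
      by (rule Linfty_norm_leI[OF diff_measurable[OF t] r])
    then show ?thesis
      using Linfty_D_nonneg[of "\<lambda>x. \<eta> t x - \<psi> t x"] unfolding w_def
      by (cases "Linfty_norm ?M (\<lambda>x. \<eta> t x - \<psi> t x)") auto
  qed
  have velocity: "AE x in ?M. \<bar>\<eta>' t x - \<omega> t x\<bar> \<le> C * w t" if t: "0 \<le> t" for t
    using eq[OF t] w(2)[OF t] AE_space
  proof eventually_elim
    case (elim x)
    then have x: "x \<in> D" by simp
    have "\<bar>avg (\<lambda>z. \<phi> x z * sin (\<eta> t z - \<eta> t x))\<bar> \<le> b\<^sub>\<Phi>"
      by (rule avg_coupling_abs_le) (use \<phi>_measurable \<eta>_measurable \<phi>_abs_le x t in auto)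
    from force_in_range[OF x this] have range: "\<eta>' t x \<in> {a..b}"
      using elim by (intro frequency_in_range) auto
    have "\<bar>\<eta>' t x - \<omega> t x\<bar> \<le> K * 0 + C * w t"
    proof (rule frequency_diff_le[OF range _ \<omega>[OF x t]])
      show "F (\<eta>' t x) = \<nu> x + \<kappa> * avg (\<lambda>z. \<phi> x z * sin (\<eta> t z - \<eta> t x))" using elim by simp
      show "\<bar>avg (\<lambda>z. \<phi> x z * sin (\<eta> t z - \<eta> t x)) - coupling t x\<bar>
          \<le> 0 + b\<^sub>\<Phi> * (w t + \<bar>\<eta> t x - \<psi> t x\<bar>)"
        unfolding coupling_def
        by (rule avg_coupling_diff_le)
           (use w(2)[OF t] \<phi>_measurable \<eta>_measurable \<psi>_measurable \<phi>_abs_le x t in auto)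
      show "w t + \<bar>\<eta> t x - \<psi> t x\<bar> \<le> 2 * w t" using elim by simp
    qed auto
    then show ?case by simp
  qed
  have zero: "w t = 0" if t: "0 \<le> t" for t
  proof (rule dini_gronwall_zero[OF w(1) _ C_nonneg _ t])
    have "AE x in ?M. \<bar>\<eta> 0 x - \<psi> 0 x\<bar> \<le> 0"
      using init AE_space by eventually_elim (simp add: \<psi>_init)
    then show "w 0 = 0" using w_le[of 0 0] w(1)[of 0] by simp
  next
    fix t e :: real assume t: "0 \<le> t" and e: "0 < e"
    have "((\<lambda>s. Linfty_norm ?M (\<lambda>x. (\<eta> s x - \<eta> t x) / (s - t) - \<eta>' t x)) \<longlongrightarrow> 0) (at t within {0..})"
      using C1 t by (simp add: C1_Linfty_with_def)
    moreover have "0 < ereal (e / 2)" using e by simp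
    ultimately have "\<forall>\<^sub>F s in at t within {0..}.
        Linfty_norm ?M (\<lambda>x. (\<eta> s x - \<eta> t x) / (s - t) - \<eta>' t x) < ereal (e / 2)"
      by (rule order_tendstoD(2))
    moreover have "0 < e / 2" using e by simp
    note eventually_W_small[OF this, of t]
    ultimately show "\<forall>\<^sub>F s in at t within {0..}. \<bar>w s - w t\<bar> \<le> \<bar>s - t\<bar> * (C * w t + e)"
    proof eventually_elim
      case (elim s)
      then have s: "0 \<le> s" and st: "s \<noteq> t" by auto
      \<comment> \<open>All null sets occurring here belong to the two fixed times \<open>s\<close> and \<open>t\<close>.\<close>
      have incr: "AE x in ?M. \<bar>(\<eta> s x - \<psi> s x) - (\<eta> t x - \<psi> t x)\<bar> \<le> \<bar>s - t\<bar> * (C * w t + e)"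
        using Linfty_norm_AE[of "\<lambda>x. (\<eta> s x - \<eta> t x) / (s - t) - \<eta>' t x" ?M] velocity[OF t] AE_space
      proof eventually_elim
        case (elim x)
        then have x: "x \<in> D" by simp
        have "ereal \<bar>(\<eta> s x - \<eta> t x) / (s - t) - \<eta>' t x\<bar> < ereal (e / 2)"
          using elim(1) \<open>Linfty_norm ?M _ < _\<close> by (rule le_less_trans)
        moreover have "\<bar>(\<psi> s x - \<psi> t x) / (s - t) - \<omega> t x\<bar> \<le> e / 2"
          using \<psi>_difference_quotient[OF x s t st] \<open>0 \<le> s \<and> s \<noteq> t \<and> W * \<bar>s - t\<bar> \<le> e / 2\<close> by linarith
        ultimately have "\<bar>(\<eta> s x - \<eta> t x) / (s - t) - (\<psi> s x - \<psi> t x) / (s - t)\<bar> \<le> C * w t + e"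
          using elim(2) unfolding less_ereal.simps by linarith
        moreover have "(\<eta> s x - \<eta> t x) / (s - t) - (\<psi> s x - \<psi> t x) / (s - t)
            = ((\<eta> s x - \<psi> s x) - (\<eta> t x - \<psi> t x)) / (s - t)"
          unfolding diff_divide_distrib[symmetric] by (rule arg_cong[of _ _ "\<lambda>y. y / (s - t)"]) simp
        ultimately have "\<bar>((\<eta> s x - \<psi> s x) - (\<eta> t x - \<psi> t x)) / (s - t)\<bar> \<le> C * w t + e"
          by simp
        then show ?case
          using st by (simp add: abs_divide pos_divide_le_eq mult.commute)
      qed
      have "AE x in ?M. \<bar>\<eta> s x - \<psi> s x\<bar> \<le> w t + \<bar>s - t\<bar> * (C * w t + e)"
        using incr w(2)[OF t] by eventually_elim linarith
      moreover have "AE x in ?M. \<bar>\<eta> t x - \<psi> t x\<bar> \<le> w s + \<bar>s - t\<bar> * (C * w t + e)"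
        using incr w(2)[OF s] by eventually_elim linarith
      ultimately show ?case
        using w_le[OF s] w_le[OF t] by (fastforce simp: abs_le_iff)
    qed
  qed
  show ?thesis
    unfolding Linfty_curve_eq_def
  proof (intro allI impI)
    fix t :: real assume t: "0 \<le> t"
    show "AE x in ?M. \<eta> t x = \<psi> t x"
      using w(2)[OF t] unfolding zero[OF t] by eventually_elim simp
  qed
qed

end

lemma Linfty_curve_eq_sym: "Linfty_curve_eq M f g \<Longrightarrow> Linfty_curve_eq M g f"
  by (simp add: Linfty_curve_eq_def eq_commute)

lemma Linfty_curve_eq_trans: "Linfty_curve_eq M f g \<Longrightarrow> Linfty_curve_eq M g h \<Longrightarrow> Linfty_curve_eq M f h"
  by (force simp: Linfty_curve_eq_def elim: eventually_elim2)

text \<open>The bounds on \<open>F'\<close> are its extrema over the compact interval \<open>[a, b]\<close>.\<close>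

lemma frequency_law_exists:
  assumes F_C2: "C2_on (sym_interval L) F"
    and F_deriv_pos: "\<forall>v\<in>sym_interval L. 0 < deriv F v"
    and ab: "- L < ereal a" "a < b" "ereal b < L"
  shows "\<exists>m B. frequency_law F (sym_interval L) a b m B"
proof -
  define S where "S = sym_interval L"
  have conv: "v \<in> S" if "x \<in> S" "y \<in> S" "x \<le> v" "v \<le> y" for x y v
    unfolding S_def sym_interval_def mem_Collect_eq
  proof
    have xy: "- L < ereal x" "ereal y < L" using that(1,2) unfolding S_def sym_interval_def by blast+
    show "- L < ereal v" by (rule less_le_trans[OF xy(1)]) (simp only: ereal_less_eq that)
    show "ereal v < L" by (rule le_less_trans[OF _ xy(2)]) (simp only: ereal_less_eq that)
  qed
  have "ereal a < L" by (rule less_trans[OF _ ab(3)]) (simp only: less_ereal.simps ab(2))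
  moreover have "- L < ereal b" by (rule less_trans[OF ab(1)]) (simp only: less_ereal.simps ab(2))
  ultimately have "a \<in> S" "b \<in> S"
    unfolding S_def sym_interval_def using ab by blast+
  then have sub: "{a..b} \<subseteq> S" using conv[of a b] by (simp add: subset_iff)
  have op: "open S"
  proof -
    have "open ({x. - L < ereal x} \<inter> {x. ereal x < L})"
      by (intro open_Int open_Collect_less continuous_intros)
    then show ?thesis by (simp add: S_def sym_interval_def Collect_conj_eq)
  qed
  have "continuous_on S (deriv F)"
    using F_C2 unfolding C2_on_def S_def[symmetric]
    by (simp add: C1_differentiable_imp_continuous_on)
  then have cont: "continuous_on {a..b} (deriv F)" using sub by (rule continuous_on_subset)
  have ne: "{a..b} \<noteq> {}" using ab by simp
  obtain p where p: "p \<in> {a..b}" "\<And>v. v \<in> {a..b} \<Longrightarrow> deriv F p \<le> deriv F v"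
    using continuous_attains_inf[OF compact_Icc ne cont] by blast
  obtain q where q: "q \<in> {a..b}" "\<And>v. v \<in> {a..b} \<Longrightarrow> deriv F v \<le> deriv F q"
    using continuous_attains_sup[OF compact_Icc ne cont] by blast
  have "frequency_law F S a b (deriv F p) (deriv F q)"
  proof
    show "is_interval S" unfolding is_interval_1 using conv by blast
    show "(F has_real_derivative deriv F v) (at v)" if "v \<in> S" for v
      using F_C2 that by (auto simp: C2_on_def S_def field_differentiable_derivI)
    show "0 < deriv F v" if "v \<in> S" for v using F_deriv_pos that by (simp add: S_def)
    show "0 < deriv F p" using F_deriv_pos p(1) sub by (auto simp: S_def)
  qed (use op sub ab p q in auto)
  then show ?thesis unfolding S_def by blast
qed

theorem theorem4p1:
  fixes L :: ereal and F :: "real \<Rightarrow> real"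
    and D :: "'a::euclidean_space set" and \<kappa> :: real
    and \<nu> \<theta>0 :: "'a \<Rightarrow> real" and \<phi> :: "'a \<Rightarrow> 'a \<Rightarrow> real"
    and P :: "nat \<Rightarrow> nat \<Rightarrow> 'a set"
    and a\<^sub>\<Phi> b\<^sub>\<Phi> a\<^sub>G b\<^sub>G \<theta>s :: real
    and \<Theta> :: "nat \<Rightarrow> nat \<Rightarrow> real \<Rightarrow> real"
  assumes L_pos: "0 < L"
    and F_C2: "C2_on (sym_interval L) F"
    and F_odd: "\<forall>v\<in>sym_interval L. F (- v) = - F v"
    and F_deriv_pos: "\<forall>v\<in>sym_interval L. 0 < deriv F v"
    and D_compact: "compact D" and D_pos: "0 < measure lebesgue D"
    and \<kappa>_pos: "0 < \<kappa>"
    and \<phi>_pos: "\<forall>x\<in>D. \<forall>y\<in>D. 0 < \<phi> x y"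
    and \<phi>_sym: "\<forall>x\<in>D. \<forall>y\<in>D. \<phi> x y = \<phi> y x"
    and B1: "dyadic_partitions D P"
    and B2: "continuous_on D \<nu>" "continuous_on (D \<times> D) (\<lambda>(x, y). \<phi> x y)" "continuous_on D \<theta>0"
    and B3_params: "0 < a\<^sub>\<Phi>" "a\<^sub>\<Phi> \<le> b\<^sub>\<Phi>" "- L < ereal a\<^sub>G" "a\<^sub>G < b\<^sub>G" "ereal b\<^sub>G < L"
      "0 < \<theta>s" "\<theta>s < pi / 2"
    and B3_\<theta>0: "osc D \<theta>0 \<le> \<theta>s"
    and B3_\<phi>: "\<forall>x\<in>D. \<forall>y\<in>D. a\<^sub>\<Phi> \<le> \<phi> x y \<and> \<phi> x y \<le> b\<^sub>\<Phi>"
    and B3_\<kappa>: "\<kappa> > max (osc D \<nu> / (a\<^sub>\<Phi> * sin \<theta>s))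
                  (2 * max_inv_quotient F a\<^sub>G b\<^sub>G /
                    (a\<^sub>\<Phi> * (min_deriv_inverse L F a\<^sub>G b\<^sub>G)\<^sup>2 * cos \<theta>s))"
    and B3_\<nu>: "\<forall>x\<in>D. F a\<^sub>G + \<kappa> * b\<^sub>\<Phi> \<le> \<nu> x \<and> \<nu> x \<le> F b\<^sub>G - \<kappa> * b\<^sub>\<Phi>"
    and lattice: "\<forall>N\<ge>1. lattice_solution L F \<kappa> (2 ^ N)
        (\<lambda>\<alpha>. cell_mean D N (P N \<alpha>) \<nu>)
        (\<lambda>\<alpha> \<beta>. cell_mean2 D N (P N \<alpha>) (P N \<beta>) \<phi>)
        (\<lambda>\<alpha>. cell_mean D N (P N \<alpha>) \<theta>0) (\<Theta> N)"
  shows "\<exists>\<theta>. (C1_Linfty (lebesgue_on D) \<theta> \<and> uniform_limit_of_lattice D P \<Theta> \<theta> \<and>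
              continuous_version_is_unique_solution L F \<kappa> D \<nu> \<phi> \<theta>0 \<theta>) \<and>
           (\<forall>\<theta>2. C1_Linfty (lebesgue_on D) \<theta>2 \<and> uniform_limit_of_lattice D P \<Theta> \<theta>2 \<and>
              continuous_version_is_unique_solution L F \<kappa> D \<nu> \<phi> \<theta>0 \<theta>2 \<longrightarrow>
              Linfty_curve_eq (lebesgue_on D) \<theta>2 \<theta>)"
proof -
  obtain m B where "frequency_law F (sym_interval L) a\<^sub>G b\<^sub>G m B"
    using frequency_law_exists[OF F_C2 F_deriv_pos B3_params(3,4,5)] by blast
  then interpret frequency_law F "sym_interval L" a\<^sub>G b\<^sub>G m B .
  define velocity where "velocity N \<alpha> \<omega> \<longleftrightarrow> continuous_on {0..} \<omega> \<and>
      (\<forall>t\<ge>0. (\<Theta> N \<alpha> has_real_derivative \<omega> t) (at t within {0..})) \<and>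
      (\<forall>t>0. \<omega> t \<in> sym_interval L \<and> F (\<omega> t) = cell_mean D N (P N \<alpha>) \<nu> + \<kappa> / real (2 ^ N) *
        (\<Sum>\<beta>\<in>{1..2^N}. cell_mean2 D N (P N \<alpha>) (P N \<beta>) \<phi> * sin (\<Theta> N \<beta> t - \<Theta> N \<alpha> t)))" for N \<alpha> \<omega>
  have "\<exists>\<omega>. velocity N \<alpha> \<omega>" if "1 \<le> N" "\<alpha> \<in> {1..2^N}" for N \<alpha>
    using lattice that unfolding lattice_solution_def velocity_def by blast
  then obtain \<Omega> where "\<And>N \<alpha>. 1 \<le> N \<Longrightarrow> \<alpha> \<in> {1..2^N} \<Longrightarrow> velocity N \<alpha> (\<Omega> N \<alpha>)"
    by metis
  note \<Omega> = this[unfolded velocity_def]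
  have "osc D \<nu> / (a\<^sub>\<Phi> * sin \<theta>s) < \<kappa>" using B3_\<kappa> by simp
  moreover have "0 < a\<^sub>\<Phi> * sin \<theta>s"
    using B3_params by (intro mult_pos_pos sin_gt_zero) auto
  ultimately have osc: "osc D \<nu> < \<kappa> * a\<^sub>\<Phi> * sin \<theta>s"
    by (simp add: pos_divide_less_eq mult.assoc)
  interpret kuramoto_continuum F "sym_interval L" a\<^sub>G b\<^sub>G m B D P \<kappa> a\<^sub>\<Phi> b\<^sub>\<Phi> \<theta>s \<nu> \<theta>0 \<phi> \<Theta> \<Omega>
  proof (unfold_locales)
    show "\<Theta> N \<alpha> 0 = cell_mean D N (P N \<alpha>) \<theta>0" if "1 \<le> N" "\<alpha> \<in> {1..2^N}" for N \<alpha>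
      using lattice that by (simp add: lattice_solution_def)
    show "F (\<Omega> N \<alpha> t) = cell_mean D N (P N \<alpha>) \<nu> + \<kappa> / 2 ^ N *
        (\<Sum>\<beta>\<in>{1..2^N}. cell_mean2 D N (P N \<alpha>) (P N \<beta>) \<phi> * sin (\<Theta> N \<beta> t - \<Theta> N \<alpha> t))"
      if "1 \<le> N" "\<alpha> \<in> {1..2^N}" "0 < t" for N \<alpha> t
      using \<Omega>[OF that(1,2)] that(3) by simp
    show "(\<Theta> N \<alpha> has_real_derivative \<Omega> N \<alpha> t) (at t within {0..})" if "1 \<le> N" "\<alpha> \<in> {1..2^N}" "0 \<le> t" for N \<alpha> t
      using \<Omega>[OF that(1,2)] that(3) by blast
    show "continuous_on {0..} (\<Omega> N \<alpha>)" if "1 \<le> N" "\<alpha> \<in> {1..2^N}" for N \<alpha>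
      using \<Omega>[OF that] by blast
    show "\<Omega> N \<alpha> t \<in> sym_interval L" if "1 \<le> N" "\<alpha> \<in> {1..2^N}" "0 < t" for N \<alpha> t
      using \<Omega>[OF that(1,2)] that(3) by blast
  qed (fact D_compact D_pos B1 B2 B3_params B3_\<theta>0 osc \<kappa>_pos B3_\<phi>[rule_format] B3_\<nu>[rule_format] \<phi>_sym[rule_format])+
  have unique: "continuous_version_is_unique_solution L F \<kappa> D \<nu> \<phi> \<theta>0 \<psi>"
    unfolding continuous_version_is_unique_solution_def
    using \<psi>_continuous \<psi>_solution[OF refl] classical_solution_unique[OF refl]
    by (intro exI[of _ \<psi>]) (auto simp: Linfty_curve_eq_def)
  show ?thesis
  proof (intro exI[of _ \<psi>] conjI allI impI unique \<psi>_limit)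
    show "C1_Linfty (lebesgue_on D) \<psi>"
      using \<psi>_C1 by (auto simp: C1_Linfty_def)
    fix \<theta>2 assume "C1_Linfty (lebesgue_on D) \<theta>2 \<and> uniform_limit_of_lattice D P \<Theta> \<theta>2 \<and>
      continuous_version_is_unique_solution L F \<kappa> D \<nu> \<phi> \<theta>0 \<theta>2"
    \<comment> \<open>The continuous version of \<open>\<theta>2\<close> is a classical solution and hence agrees with \<open>\<psi>\<close>.\<close>
    then obtain \<psi>2 where "Linfty_curve_eq (lebesgue_on D) \<psi>2 \<theta>2"
        "classical_solution L F \<kappa> D \<nu> \<phi> \<theta>0 \<psi>2"
      unfolding continuous_version_is_unique_solution_def by blast
    then show "Linfty_curve_eq (lebesgue_on D) \<theta>2 \<psi>"
      using classical_solution_unique[OF refl] Linfty_curve_eq_sym Linfty_curve_eq_trans by blast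
  qed
qed

end
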